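(* Let $G$ be a finitely generated group and let $G_*$ be a subgroup of $G$. Then $G_*$ is a context-free subgroup of $G$ if and only if there exists a group homomorphism $\phi: G \to V$ with $\phi^{-1}(V_* ) = G_*$.
   Context: R. Thompson's group $V$: for a word $\alpha\in\{0,1\}^*$ the cone $\alpha\{0,1\}^\omega$ is the set of right-infinite binary words with prefix $\alpha$. A prefix partition is a finite set $\mathcal A\subset\{0,1\}^*$ such that the cones $\alpha\{0,1\}^\omega$, $\alpha\in\mathcal A$, partition $\{0,1\}^\omega$. A bijection $f:\mathcal A\to\mathcal B$ between prefix partitions induces the map $[f]:\{0,1\}^\omega\to\{0,1\}^\omega$, $\alpha\eta\mapsto f(\alpha)\eta$ ($\alpha\in\mathcal A$, $\eta\in\{0,1\}^\omega$). $V$ is the group of all such maps, acting on $\{0,1\}^\omega$ on the right. $V_*$ is the stabiliser in $V$ of the point $0^\omega=000\cdots$. Context-free subgroups: a symmetric alphabet is a finite set $\Sigma$ with an involution $s\mapsto\overline s$, extended to the free monoid $\Sigma^*$ by $\overline{s_1\cdots s_n}=\overline{s_n}\cdots\overline{s_1}$. A monoid homomorphism $\rho:\Sigma^*\to G$ is symmetric if $\rho(\overline\sigma)=\rho(\sigma)^{-1}$ for all $\sigma\in\Sigma^*$. The membership problem of $G_*$ in $G$ with respect to a symmetric surjective homomorphism $\rho:\Sigma^*\to G$ is the language $\rho^{-1}(G_* )\subset\Sigma^*$. The subgroup $G_*$ is a context-free subgroup of the finitely generated group $G$ if this language is context-free (in the usual sense: accepted by a pushdown automaton, equivalently generated by a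 context-free grammar); this does not depend on the choice of $\Sigma$ and $\rho$. *)

theory Defs
  imports "HOL-Algebra.Generated_Groups" "HOL-Library.Disjoint_Sets" "HOL-Library.Stream"
begin

section \<open>Thompson's group V\<close>

text \<open>Binary digits are booleans, with \<^const>\<open>False\<close> for 0; infinite words are streams.\<close>

definition cone :: "bool list \<Rightarrow> bool stream set" where
  "cone \<alpha> = {\<alpha> @- \<eta> | \<eta>. True}"

definition prefix_partition :: "bool list set \<Rightarrow> bool" where
  "prefix_partition A \<longleftrightarrow>
     finite A \<and> disjoint_family_on cone A \<and> (\<Union>\<alpha>\<in>A. cone \<alpha>) = UNIV"

text \<open>Since the cones over \<open>A\<close> partition the space, \<open>A\<close> and \<open>f\<close> determine \<open>g\<close> uniquely.\<close>

definition induces :: "bool list set \<Rightarrow> (bool list \<Rightarrow> bool list) \<Rightarrow> (bool stream \<Rightarrow> bool stream) \<Rightarrow> bool"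
  where "induces A f g \<longleftrightarrow> (\<forall>\<alpha>\<in>A. \<forall>\<eta>. g (\<alpha> @- \<eta>) = f \<alpha> @- \<eta>)"

text \<open>Maps act on the right: in a product, the left factor is applied first.\<close>

definition Thompson_V :: "(bool stream \<Rightarrow> bool stream) monoid" where
  "Thompson_V =
     \<lparr>carrier = {g. \<exists>A B f. prefix_partition A \<and> prefix_partition B \<and> bij_betw f A B \<and> induces A f g},
      mult = (\<lambda>g h. h \<circ> g),
      one = id\<rparr>"

definition Thompson_V_stab :: "(bool stream \<Rightarrow> bool stream) set" where
  "Thompson_V_stab = {g \<in> carrier Thompson_V. g (sconst False) = sconst False}"


section \<open>Context-free languages\<close>

datatype ('n, 't) symbol = Nt 'n | Tm 't

type_synonym ('n, 't) production = "'n \<times> ('n, 't) symbol list"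

inductive derive_step ::
    "('n, 't) production set \<Rightarrow> ('n, 't) symbol list \<Rightarrow> ('n, 't) symbol list \<Rightarrow> bool"
  for P where
  "(X, \<gamma>) \<in> P \<Longrightarrow> derive_step P (u @ Nt X # v) (u @ \<gamma> @ v)"

definition grammar_language :: "('n, 't) production set \<Rightarrow> 'n \<Rightarrow> 't list set" where
  "grammar_language P S = {w. rtranclp (derive_step P) [Nt S] (map Tm w)}"

text \<open>A grammar has finitely many productions, hence finitely many relevant nonterminals and
  terminals; so taking the nonterminals from \<^typ>\<open>nat\<close> is no restriction.\<close>

definition context_free :: "'t list set \<Rightarrow> bool" where
  "context_free L \<longleftrightarrow>
     (\<exists>(P :: (nat, 't) production set) S. finite P \<and> L = grammar_language P S)"


section \<open>Context-free subgroups\<close>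

definition finitely_generated :: "('a, 'b) monoid_scheme \<Rightarrow> bool" where
  "finitely_generated G \<longleftrightarrow> (\<exists>S. finite S \<and> S \<subseteq> carrier G \<and> generate G S = carrier G)"

definition symmetric_alphabet :: "'s set \<Rightarrow> ('s \<Rightarrow> 's) \<Rightarrow> bool" where
  "symmetric_alphabet \<Sigma> bar \<longleftrightarrow>
     finite \<Sigma> \<and> (\<forall>s\<in>\<Sigma>. bar s \<in> \<Sigma> \<and> bar (bar s) = s)"

definition word_bar :: "('s \<Rightarrow> 's) \<Rightarrow> 's list \<Rightarrow> 's list" where
  "word_bar bar w = rev (map bar w)"

definition word_monoid :: "'s set \<Rightarrow> 's list monoid" where
  "word_monoid \<Sigma> = \<lparr>carrier = lists \<Sigma>, mult = (@), one = []\<rparr>"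

definition symmetric_hom ::
    "'s set \<Rightarrow> ('s \<Rightarrow> 's) \<Rightarrow> ('a, 'b) monoid_scheme \<Rightarrow> ('s list \<Rightarrow> 'a) \<Rightarrow> bool" where
  "symmetric_hom \<Sigma> bar G \<rho> \<longleftrightarrow>
     \<rho> \<in> hom (word_monoid \<Sigma>) G \<and> \<rho> [] = \<one>\<^bsub>G\<^esub> \<and>
     (\<forall>\<sigma>\<in>lists \<Sigma>. \<rho> (word_bar bar \<sigma>) = inv\<^bsub>G\<^esub> (\<rho> \<sigma>))"

definition membership_problem :: "'s set \<Rightarrow> ('s list \<Rightarrow> 'a) \<Rightarrow> 'a set \<Rightarrow> 's list set" where
  "membership_problem \<Sigma> \<rho> H = {\<sigma> \<in> lists \<Sigma>. \<rho> \<sigma> \<in> H}"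

text \<open>Whether the membership problem is context-free does not depend on the symmetric alphabet
  and the symmetric surjection, and every finite alphabet can be renamed into \<^typ>\<open>nat\<close>.\<close>

definition context_free_subgroup :: "'a set \<Rightarrow> ('a, 'b) monoid_scheme \<Rightarrow> bool" where
  "context_free_subgroup H G \<longleftrightarrow>
     (\<exists>(\<Sigma> :: nat set) bar \<rho>.
        symmetric_alphabet \<Sigma> bar \<and> symmetric_hom \<Sigma> bar G \<rho> \<and>
        \<rho> ` lists \<Sigma> = carrier G \<and> context_free (membership_problem \<Sigma> \<rho> H))"

end

theory Submission
  imports Defs "HOL-Library.Sublist" "HOL-Library.Countable"
begin

text \<open>
  The subgroup \<open>H\<close> is the stabiliser of the coset \<open>H\<close> in the action of \<open>G\<close> on its right cosets, so a
  word belongs to the membership problem iff it labels a closed walk at the base point of the Schreier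
  graph of \<open>H\<close>. Both directions compare this graph with a pushdown store: the point \<open>w000\<dots>\<close> of Cantor
  space is a store with content \<open>w\<close> and its top at the left end, and an element of \<open>V\<close> rewrites the top.

  From \<open>V\<close> to a grammar (\<open>context_free_point_stabilizer\<close>). Say that a word of generators drives \<open>\<alpha>\<close> to
  \<open>\<beta>\<close> if it maps \<open>\<alpha>\<eta>\<close> to \<open>\<beta>\<eta>\<close> for all \<open>\<eta>\<close> and never needs a letter of \<open>\<eta>\<close>. If the last letter of \<open>\<alpha>\<close>
  is never needed either, it can be dropped from both \<open>\<alpha>\<close> and \<open>\<beta>\<close>; otherwise the word splits at a moment
  at which the content is short. Hence finitely many pairs \<open>(\<alpha>, \<beta>)\<close> serve as nonterminals, together with
  nonterminals for the words that map \<open>\<alpha>000\<dots>\<close> to \<open>000\<dots>\<close>.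

  From a grammar to \<open>V\<close> (\<open>hom_to_Thompson_V_if_context_free\<close>). A branch of level \<open>n\<close> is a connected
  component of the set of points at distance at least \<open>n\<close> from the base point; its rim consists of its
  points at distance exactly \<open>n\<close>. A derivation of a closed walk triangulates the walk with chords of
  bounded length. It follows that rims have bounded diameter (\<open>short_shortcut\<close>), and that bounded data
  near the rim determine which walks inside a branch have the same end point (\<open>transfer\<close>). So there are
  only finitely many branches up to isomorphism (\<open>finite_branch_types\<close>, \<open>branch_iso_if_same_type\<close>).

  A point \<open>x\<close> at distance \<open>n\<close> determines branches \<open>C\<^sub>0 \<supseteq> \<dots> \<supseteq> C\<^sub>n\<close> with \<open>x\<close> on the rim of \<open>C\<^sub>n\<close>, and \<open>C\<^sub>0\<close> is
  the whole graph. The address of \<open>x\<close> is a binary word that gives the type of \<open>C\<^sub>n\<close> and the position of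
  \<open>x\<close> on its rim, then the type of \<open>C\<^sub>n\<^sub>-\<^sub>1\<close> and the place of \<open>C\<^sub>n\<close> in it, and so on down to \<open>C\<^sub>0\<close>. An edge of
  the graph changes the distance by at most one, so a generator changes only a bounded prefix of the
  address, in a way that depends only on this prefix: this defines an element of \<open>V\<close> (\<open>address_act\<close>).
  The relations of \<open>G\<close> hold for these elements on all points \<open>address x @- \<eta>\<close>. Since the codes are
  complete, such points are dense (\<open>address_dense\<close>), so the relations hold on all of Cantor space and
  there is a homomorphism to \<open>V\<close>. The address of the base point consists of zeros only, and therefore
  exactly the elements of \<open>H\<close> fix \<open>000\<dots>\<close>.
\<close>

section \<open>Derivation trees\<close>

text \<open>
  Derivation forests, read off from left to right. A nonterminal is expanded and the rest of the symbol
  string follows, so that forests branch binarily whatever the lengths of the productions; the suffixes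
  of right-hand sides take the place of the auxiliary nonterminals of a normal form.
\<close>

inductive yields :: "('n, 't) production set \<Rightarrow> ('n, 't) symbol list \<Rightarrow> 't list \<Rightarrow> bool"
  for P where
  yields_Nil: "yields P [] []"
| yields_Tm: "yields P \<gamma> w \<Longrightarrow> yields P (Tm a # \<gamma>) (a # w)"
| yields_Nt: "(X, \<delta>) \<in> P \<Longrightarrow> yields P \<delta> u \<Longrightarrow> yields P \<gamma> v \<Longrightarrow> yields P (Nt X # \<gamma>) (u @ v)"

lemma yields_Nil_iff [simp]: "yields P [] w \<longleftrightarrow> w = []"
  by (auto intro: yields.intros elim: yields.cases)

lemma yields_append:
  "yields P \<gamma> u \<Longrightarrow> yields P \<delta> v \<Longrightarrow> yields P (\<gamma> @ \<delta>) (u @ v)"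
proof (induction rule: yields.induct)
  case (yields_Nt X \<delta>' u \<gamma> v')
  then show ?case using yields.yields_Nt[of X \<delta>' P u "\<gamma> @ \<delta>" "v' @ v"] by simp
qed (auto intro: yields.intros)

lemma yields_appendE:
  assumes "yields P (\<gamma> @ \<delta>) w"
  obtains u v where "w = u @ v" "yields P \<gamma> u" "yields P \<delta> v"
  using assms
proof (induction \<gamma> arbitrary: w thesis)
  case Nil
  then show ?case by (auto intro: yields.intros)
next
  case (Cons x \<gamma>)
  from Cons.prems(2) show ?case
  proof (cases rule: yields.cases)
    case (yields_Tm \<gamma>' w' a)
    then obtain u v where "w' = u @ v" "yields P \<gamma> u" "yields P \<delta> v"
      using Cons.IH[of w'] by auto
    then show thesis using yields_Tm Cons.prems(1)[of "a # u" v] by (auto intro: yields.intros)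
  next
    case (yields_Nt X \<delta>' u' \<gamma>' v')
    then obtain u v where "v' = u @ v" "yields P \<gamma> u" "yields P \<delta> v"
      using Cons.IH[of v'] by auto
    then show thesis
      using yields_Nt Cons.prems(1)[of "u' @ u" v] by (auto intro: yields.intros)
  qed (use Cons in auto)
qed

lemma yields_map_Tm: "yields P (map Tm w) w"
  by (induction w) (auto intro: yields.intros)

lemma derive_step_yields:
  assumes "derive_step P \<gamma> \<delta>" "yields P \<delta> w"
  shows "yields P \<gamma> w"
  using assms
proof (induction rule: derive_step.induct)
  case (1 X \<beta> u v)
  from 1(2) obtain w1 w2 w3 where "w = w1 @ w2 @ w3" "yields P u w1" "yields P \<beta> w2" "yields P v w3"
    by (elim yields_appendE) auto
  then show ?case using yields_append[OF _ yields_Nt[OF 1(1)]] by simp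
qed

lemma derive_step_context:
  "derive_step P \<gamma> \<delta> \<Longrightarrow> derive_step P (u @ \<gamma> @ v) (u @ \<delta> @ v)"
proof (induction rule: derive_step.induct)
  case (1 X \<beta> u' v')
  then show ?case using derive_step.intros[of X \<beta> P "u @ u'" "v' @ v"] by simp
qed

lemma derives_context:
  "(derive_step P)\<^sup>*\<^sup>* \<gamma> \<delta> \<Longrightarrow> (derive_step P)\<^sup>*\<^sup>* (u @ \<gamma> @ v) (u @ \<delta> @ v)"
  by (induction rule: rtranclp_induct) (auto intro: rtranclp.rtrancl_into_rtrancl derive_step_context)

lemma yields_derives: "yields P \<gamma> w \<Longrightarrow> (derive_step P)\<^sup>*\<^sup>* \<gamma> (map Tm w)"
proof (induction rule: yields.induct)
  case (yields_Tm \<gamma> w a)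
  then show ?case using derives_context[of P \<gamma> "map Tm w" "[Tm a]" "[]"] by simp
next
  case (yields_Nt X \<delta> u \<gamma> v)
  have "derive_step P (Nt X # \<gamma>) (\<delta> @ \<gamma>)"
    using derive_step.intros[OF yields_Nt.hyps(1), of "[]" \<gamma>] by simp
  moreover have "(derive_step P)\<^sup>*\<^sup>* (\<delta> @ \<gamma>) (map Tm u @ \<gamma>)"
    using derives_context[OF yields_Nt.IH(1), of "[]" \<gamma>] by simp
  moreover have "(derive_step P)\<^sup>*\<^sup>* (map Tm u @ \<gamma>) (map Tm u @ map Tm v)"
    using derives_context[OF yields_Nt.IH(2), of "map Tm u" "[]"] by simp
  ultimately show ?case by (auto intro: converse_rtranclp_into_rtranclp rtranclp_trans)
qed simp

lemma grammar_language_yields: "grammar_language P S = {w. yields P [Nt S] w}"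
proof -
  have "yields P \<gamma> w" if "(derive_step P)\<^sup>*\<^sup>* \<gamma> (map Tm w)" for \<gamma> w
    using that
    by (induction rule: converse_rtranclp_induct) (auto intro: yields_map_Tm derive_step_yields)
  then show ?thesis by (auto simp: grammar_language_def dest: yields_derives)
qed

section \<open>Schreier graphs and their branches\<close>

text \<open>
  The graphs in which every letter acts as a permutation of the points and \<open>bar\<close> gives the inverse
  permutation. Words act through \<open>foldl act\<close>.
\<close>

locale schreier_graph =
  fixes X :: "'x set" and \<Sigma> :: "'s set" and act :: "'x \<Rightarrow> 's \<Rightarrow> 'x" (infixl "\<cdot>" 70)
    and bar :: "'s \<Rightarrow> 's" and base :: 'x
  assumes finite_letters: "finite \<Sigma>"
    and bar_in [simp]: "s \<in> \<Sigma> \<Longrightarrow> bar s \<in> \<Sigma>"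
    and bar_bar [simp]: "s \<in> \<Sigma> \<Longrightarrow> bar (bar s) = s"
    and act_in [simp]: "x \<in> X \<Longrightarrow> s \<in> \<Sigma> \<Longrightarrow> x \<cdot> s \<in> X"
    and act_bar [simp]: "x \<in> X \<Longrightarrow> s \<in> \<Sigma> \<Longrightarrow> x \<cdot> s \<cdot> bar s = x"
    and base_in [simp]: "base \<in> X"
    and reachable: "x \<in> X \<Longrightarrow> \<exists>w\<in>lists \<Sigma>. foldl act base w = x"
begin

abbreviation walk (infixl "\<star>" 70) where "x \<star> w \<equiv> foldl act x w"

lemma act_bar' [simp]: "x \<in> X \<Longrightarrow> s \<in> \<Sigma> \<Longrightarrow> x \<cdot> bar s \<cdot> s = x"
  using act_bar[of x "bar s"] by simp

lemma walk_in [simp]: "x \<in> X \<Longrightarrow> w \<in> lists \<Sigma> \<Longrightarrow> x \<star> w \<in> X"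
  by (induction w arbitrary: x) auto

lemma word_bar_in [simp]: "w \<in> lists \<Sigma> \<Longrightarrow> word_bar bar w \<in> lists \<Sigma>"
  by (auto simp: word_bar_def)

lemma length_word_bar [simp]: "length (word_bar bar w) = length w"
  by (simp add: word_bar_def)

lemma walk_word_bar [simp]: "x \<in> X \<Longrightarrow> w \<in> lists \<Sigma> \<Longrightarrow> x \<star> w \<star> word_bar bar w = x"
  by (induction w arbitrary: x) (auto simp: word_bar_def)

lemma walk_inj: "x \<star> w = y \<star> w \<Longrightarrow> x \<in> X \<Longrightarrow> y \<in> X \<Longrightarrow> w \<in> lists \<Sigma> \<Longrightarrow> x = y"
  by (metis walk_word_bar)

definition lev :: "'x \<Rightarrow> nat" where
  "lev x = (LEAST n. \<exists>w\<in>lists \<Sigma>. length w = n \<and> base \<star> w = x)"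

lemma geodesic:
  assumes "x \<in> X"
  obtains w where "w \<in> lists \<Sigma>" "length w = lev x" "base \<star> w = x"
proof -
  have "\<exists>n. \<exists>w\<in>lists \<Sigma>. length w = n \<and> base \<star> w = x" using reachable[OF assms] by blast
  from LeastI_ex[OF this] show ?thesis using that unfolding lev_def by blast
qed

lemma lev_le_length: "w \<in> lists \<Sigma> \<Longrightarrow> lev (base \<star> w) \<le> length w"
  unfolding lev_def by (rule Least_le) auto

lemma lev_walk_le:
  assumes "x \<in> X" "w \<in> lists \<Sigma>"
  shows "lev (x \<star> w) \<le> lev x + length w"
proof -
  obtain v where v: "v \<in> lists \<Sigma>" "length v = lev x" "base \<star> v = x" by (rule geodesic[OF assms(1)])
  then show ?thesis using lev_le_length[of "v @ w"] assms by simp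
qed

lemma lev_le_walk:
  assumes "x \<in> X" "w \<in> lists \<Sigma>"
  shows "lev x \<le> lev (x \<star> w) + length w"
  using lev_walk_le[of "x \<star> w" "word_bar bar w"] assms by simp

lemma lev_act_le: "x \<in> X \<Longrightarrow> s \<in> \<Sigma> \<Longrightarrow> lev (x \<cdot> s) \<le> Suc (lev x)"
  using lev_walk_le[of x "[s]"] by simp

lemma lev_le_act: "x \<in> X \<Longrightarrow> s \<in> \<Sigma> \<Longrightarrow> lev x \<le> Suc (lev (x \<cdot> s))"
  using lev_le_walk[of x "[s]"] by simp

lemma lev_base [simp]: "lev base = 0"
  using lev_le_length[of "[]"] by simp

lemma lev_eq_0: "x \<in> X \<Longrightarrow> lev x = 0 \<longleftrightarrow> x = base"
  by (metis geodesic lev_base length_0_conv foldl_Nil)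

lemma finite_words: "finite {w \<in> lists \<Sigma>. length w \<le> n}"
  using finite_lists_length_le[OF finite_letters] by (simp add: lists_eq_set)

lemma finite_ball: "finite {x \<in> X. lev x \<le> n}"
proof (rule finite_subset)
  show "{x \<in> X. lev x \<le> n} \<subseteq> (\<lambda>w. base \<star> w) ` {w \<in> lists \<Sigma>. length w \<le> n}"
  proof
    fix x assume "x \<in> {x \<in> X. lev x \<le> n}"
    moreover then obtain w where "w \<in> lists \<Sigma>" "length w = lev x" "base \<star> w = x"
      using geodesic by blast
    ultimately show "x \<in> (\<lambda>w. base \<star> w) ` {w \<in> lists \<Sigma>. length w \<le> n}" by auto
  qed
qed (use finite_words in auto)

text \<open>
  Walks all of whose points have level at least \<open>n\<close>. Connectivity through such walks is what defines the
  components of the part of the graph at distance at least \<open>n\<close> from the base point.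
\<close>

fun stays :: "nat \<Rightarrow> 'x \<Rightarrow> 's list \<Rightarrow> bool" where
  "stays n x [] \<longleftrightarrow> n \<le> lev x"
| "stays n x (s # w) \<longleftrightarrow> n \<le> lev x \<and> s \<in> \<Sigma> \<and> stays n (x \<cdot> s) w"

lemma stays_start: "stays n x w \<Longrightarrow> n \<le> lev x"
  by (cases w) auto

lemma stays_append: "stays n x (u @ v) \<longleftrightarrow> stays n x u \<and> stays n (x \<star> u) v"
  by (induction u arbitrary: x) (auto dest: stays_start)

lemma stays_end: "stays n x w \<Longrightarrow> n \<le> lev (x \<star> w)"
  by (induction w arbitrary: x) auto

lemma stays_lists: "stays n x w \<Longrightarrow> w \<in> lists \<Sigma>"
  by (induction w arbitrary: x) auto

lemma stays_mono: "stays n x w \<Longrightarrow> m \<le> n \<Longrightarrow> stays m x w"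
  by (induction w arbitrary: x) auto

lemma stays_0: "stays 0 x w \<longleftrightarrow> w \<in> lists \<Sigma>"
  by (induction w arbitrary: x) auto

lemma stays_word_bar:
  assumes "x \<in> X" "stays n x w"
  shows "stays n (x \<star> w) (word_bar bar w)"
  using assms
proof (induction w arbitrary: x)
  case (Cons s w)
  then have w: "stays n (x \<cdot> s) w" "s \<in> \<Sigma>" "x \<cdot> s \<in> X" "n \<le> lev x" by auto
  have "x \<cdot> s \<star> w \<star> word_bar bar w = x \<cdot> s" using w stays_lists by simp
  then show ?case
    using Cons.IH[OF w(3,1)] w Cons.prems(1) stays_start[OF w(1)] by (simp add: word_bar_def stays_append)
qed (auto simp: word_bar_def)

text \<open>
  Along a geodesic to the base point the level drops by one at each step, so such a path does not leave
  the branch before it reaches the rim.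
\<close>

lemma descent:
  assumes "x \<in> X" "n \<le> lev x"
  obtains v where "stays n x v" "length v = lev x - n" "lev (x \<star> v) = n"
  using assms
proof (induction "lev x - n" arbitrary: x thesis)
  case 0
  then show ?case by (metis diff_is_0_eq foldl_Nil le_antisym length_0_conv stays.simps(1))
next
  case (Suc k)
  obtain w where w: "w \<in> lists \<Sigma>" "length w = lev x" "base \<star> w = x"
    using geodesic Suc.prems(2) by blast
  with Suc.hyps(2) obtain w' s where ws: "w = w' @ [s]" by (cases w rule: rev_cases) auto
  let ?y = "base \<star> w'"
  have y: "?y \<in> X" "s \<in> \<Sigma>" "?y \<cdot> s = x" using w ws by auto
  have l: "lev ?y \<le> length w'" using lev_le_length w ws by auto
  moreover have "lev x \<le> Suc (lev ?y)" using lev_act_le[of ?y s] y by simp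
  ultimately have "Suc (lev ?y) = lev x" using w ws by simp
  with Suc.hyps(2) have k: "k = lev ?y - n" "n \<le> lev ?y" by auto
  from Suc.hyps(1)[OF k(1) _ y(1) k(2)] obtain v
    where v: "stays n ?y v" "length v = lev ?y - n" "lev (?y \<star> v) = n" by blast
  have "x \<cdot> bar s = ?y" using y by force
  then show thesis using Suc.prems(1)[of "bar s # v"] v y k Suc.hyps(2) Suc.prems(3) by simp
qed

text \<open>
  The component of \<open>x\<close> in the set of points that are at least as far from the base point as \<open>x\<close>; so \<open>x\<close>
  itself is on the rim and serves as a root of the branch.
\<close>

definition branch :: "'x \<Rightarrow> 'x set" where
  "branch x = {x \<star> w | w. stays (lev x) x w}"

definition rim :: "'x \<Rightarrow> 'x set" where
  "rim x = {y \<in> branch x. lev y = lev x}"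

lemma branchI: "stays (lev x) x w \<Longrightarrow> x \<star> w \<in> branch x"
  by (auto simp: branch_def)

lemma branchE:
  assumes "y \<in> branch x"
  obtains w where "stays (lev x) x w" "y = x \<star> w"
  using assms by (auto simp: branch_def)

lemma branch_self [simp]: "x \<in> branch x"
  using branchI[of x "[]"] by simp

lemma branch_in: "y \<in> branch x \<Longrightarrow> x \<in> X \<Longrightarrow> y \<in> X"
  using stays_lists by (auto simp: branch_def)

lemma branch_lev: "y \<in> branch x \<Longrightarrow> lev x \<le> lev y"
  by (auto simp: branch_def dest: stays_end)

lemma branch_walk: "y \<in> branch x \<Longrightarrow> stays (lev x) y w \<Longrightarrow> y \<star> w \<in> branch x"
  by (metis branchE branchI stays_append foldl_append)

lemma branch_act: "y \<in> branch x \<Longrightarrow> s \<in> \<Sigma> \<Longrightarrow> lev x \<le> lev (y \<cdot> s) \<Longrightarrow> y \<cdot> s \<in> branch x"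
  using branch_walk[of y x "[s]"] branch_lev[of y x] by simp

lemma branch_trans: "y \<in> branch x \<Longrightarrow> z \<in> branch y \<Longrightarrow> z \<in> branch x"
  by (metis branchE branch_walk branch_lev stays_mono)

lemma branch_sym: 
  assumes "x \<in> X" "y \<in> branch x" "lev y = lev x"
  shows "x \<in> branch y"
  using assms by (metis branchE branchI stays_word_bar stays_lists walk_word_bar)

lemma branch_eqI:
  assumes "x \<in> X" "y \<in> X" "z \<in> branch x" "z \<in> branch y" "lev x = lev y"
  shows "branch x = branch y"
proof -
  obtain v where v: "stays (lev x) y v" "z = y \<star> v" using assms by (metis branchE)
  have "y = z \<star> word_bar bar v" using v assms stays_lists by simp
  then have y: "y \<in> branch x" using branch_walk[OF assms(3)] stays_word_bar[OF assms(2) v(1)] v(2) by metis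
  then have "x \<in> branch y" using branch_sym[OF assms(1)] assms(5) by simp
  with y show ?thesis using branch_trans by blast
qed

lemma branch_base [simp]: "branch base = X"
proof
  show "X \<subseteq> branch base"
  proof
    fix x assume "x \<in> X"
    then obtain w where "w \<in> lists \<Sigma>" "base \<star> w = x" using reachable by blast
    then show "x \<in> branch base" using branchI[of base w] by (simp add: stays_0)
  qed
qed (use branch_in in auto)

text \<open>
  A rooted isomorphism of branches sends the end of a walk from \<open>x\<close> to the end of the walk from \<open>y\<close> with the
  same label. It is thus determined by the roots and can be described by labels alone.
\<close>

definition branch_iso :: "'x \<Rightarrow> 'x \<Rightarrow> bool" where
  "branch_iso x y \<longleftrightarrow>
    (\<forall>w. stays (lev x) x w \<longleftrightarrow> stays (lev y) y w) \<and>
    (\<forall>v w. stays (lev x) x v \<and> stays (lev x) x w \<longrightarrow> (x \<star> v = x \<star> w \<longleftrightarrow> y \<star> v = y \<star> w)) \<and>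
    (\<forall>w. stays (lev x) x w \<longrightarrow> lev (x \<star> w) + lev y = lev (y \<star> w) + lev x)"

text \<open>
  The level of a point relative to the rim is its distance to the rim inside the branch, because a
  geodesic to the base point stays in the branch until it meets the rim. So an isomorphism that
  respects rims respects all levels.
\<close>

lemma branch_isoI:
  assumes xy: "x \<in> X" "y \<in> X"
    and st: "\<And>w. stays (lev x) x w \<longleftrightarrow> stays (lev y) y w"
    and eq: "\<And>v w. stays (lev x) x v \<Longrightarrow> stays (lev x) x w \<Longrightarrow> (x \<star> v = x \<star> w \<longleftrightarrow> y \<star> v = y \<star> w)"
    and rim: "\<And>w. stays (lev x) x w \<Longrightarrow> lev (x \<star> w) = lev x \<longleftrightarrow> lev (y \<star> w) = lev y"
  shows "branch_iso x y"
proof -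
  have *: "lev (x \<star> w) + lev y \<ge> lev (y \<star> w) + lev x"
    if xy: "x \<in> X" "y \<in> X" and st: "\<And>w. stays (lev x) x w \<longleftrightarrow> stays (lev y) y w"
      and rim: "\<And>w. stays (lev x) x w \<Longrightarrow> lev (x \<star> w) = lev x \<longleftrightarrow> lev (y \<star> w) = lev y"
      and w: "stays (lev x) x w" for x y w
  proof -
    have in_X: "x \<star> w \<in> X" using xy w stays_lists by simp
    then obtain v where v: "stays (lev x) (x \<star> w) v" "length v = lev (x \<star> w) - lev x" "lev (x \<star> w \<star> v) = lev x"
      using descent stays_end[OF w] by metis
    then have "stays (lev x) x (w @ v)" using w by (simp add: stays_append)
    then have "lev (y \<star> w \<star> v) = lev y" using rim[of "w @ v"] v by simp
    moreover have "y \<star> w \<in> X" "v \<in> lists \<Sigma>" using xy w v stays_lists by auto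
    ultimately show ?thesis using lev_le_walk[of "y \<star> w" v] v(2) stays_end[OF w] by simp
  qed
  have "lev (x \<star> w) + lev y = lev (y \<star> w) + lev x" if "stays (lev x) x w" for w
    by (rule order.antisym) (use *[of x y w] *[of y x w] that xy st rim in auto)
  then show ?thesis using st eq unfolding branch_iso_def by blast
qed

end

section \<open>Context-free graphs have finitely many branches up to isomorphism\<close>

text \<open>
  A finite set that contains the symbol strings at all nodes of derivation forests of the start symbol.
  Letters and the empty string are included so that one kind of chord also covers edges
  and equality of points.
\<close>

definition grammar_parts :: "('n, 's) production set \<Rightarrow> 'n \<Rightarrow> 's set \<Rightarrow> ('n, 's) symbol list set" where
  "grammar_parts P S \<Sigma> =
     {\<gamma>. \<exists>\<delta> \<in> insert [Nt S] ((\<lambda>a. [Tm a]) ` \<Sigma> \<union> snd ` P). suffix \<gamma> \<delta>}"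

lemma finite_grammar_parts:
  assumes "finite P" "finite \<Sigma>"
  shows "finite (grammar_parts P S \<Sigma>)"
proof -
  have "grammar_parts P S \<Sigma> = (\<Union>\<delta> \<in> insert [Nt S] ((\<lambda>a. [Tm a]) ` \<Sigma> \<union> snd ` P). set (suffixes \<delta>))"
    by (auto simp only: grammar_parts_def in_set_suffixes UN_iff mem_Collect_eq)
  also have "finite \<dots>" using assms by simp
  finally show ?thesis .
qed

lemma grammar_parts_start: "[Nt S] \<in> grammar_parts P S \<Sigma>"
  and grammar_parts_Nil: "[] \<in> grammar_parts P S \<Sigma>"
  and grammar_parts_Tm: "a \<in> \<Sigma> \<Longrightarrow> [Tm a] \<in> grammar_parts P S \<Sigma>"
  and grammar_parts_Cons: "t # \<gamma> \<in> grammar_parts P S \<Sigma> \<Longrightarrow> \<gamma> \<in> grammar_parts P S \<Sigma>"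
  and grammar_parts_production: "(Y, \<delta>) \<in> P \<Longrightarrow> \<delta> \<in> grammar_parts P S \<Sigma>"
  unfolding grammar_parts_def by (force dest: suffix_ConsD)+

locale context_free_schreier_graph = schreier_graph X \<Sigma> act bar base
  for X :: "'x set" and \<Sigma> :: "'s set" and act :: "'x \<Rightarrow> 's \<Rightarrow> 'x" (infixl "\<cdot>" 70)
    and bar :: "'s \<Rightarrow> 's" and base :: 'x +
  fixes P :: "('n, 's) production set" and S :: 'n
  assumes finite_P: "finite P"
    and closed_walks: "{w. yields P [Nt S] w} = {w \<in> lists \<Sigma>. foldl act base w = base}"
begin

abbreviation "Q \<equiv> grammar_parts P S \<Sigma>"

lemmas Q_simps [simp] = grammar_parts_start grammar_parts_Nil grammar_parts_Tm
  grammar_parts_production[where P = P]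

lemmas Q_Cons = grammar_parts_Cons[where P = P]

lemma finite_Q: "finite Q"
  by (rule finite_grammar_parts[OF finite_P finite_letters])

text \<open>
  If a symbol string occurs in a derivation of a closed walk, every word that it yields can be exchanged
  for the one that it yields there, and the result is again a closed walk. As letters act injectively,
  all these words lead from the same point to the same point. This consequence is used instead of
  the occurrence in a derivation.
\<close>

definition chord :: "('n, 's) symbol list \<Rightarrow> 'x \<Rightarrow> 'x \<Rightarrow> bool" where
  "chord \<gamma> x y \<longleftrightarrow> (\<forall>w. yields P \<gamma> w \<longrightarrow> w \<in> lists \<Sigma> \<and> x \<star> w = y)"

lemma chordD: "chord \<gamma> x y \<Longrightarrow> yields P \<gamma> w \<Longrightarrow> w \<in> lists \<Sigma> \<and> x \<star> w = y"
  by (simp add: chord_def)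

lemma chord_start: "chord [Nt S] base base"
  using closed_walks by (auto simp: chord_def)

lemma chord_Nil [simp]: "chord [] x y \<longleftrightarrow> x = y"
  by (auto simp: chord_def)

text \<open>
  Subdividing a chord into the two other sides of a triangle. The middle vertex does not depend on the word
  yielded by \<open>\<delta>\<close> because the last side \<open>v\<close> acts injectively.
\<close>

lemma chord_Nt:
  assumes "chord (Nt Y # \<gamma>) x y" "(Y, \<delta>) \<in> P" "yields P \<delta> u" "yields P \<gamma> v" "x \<in> X"
  shows "chord \<delta> x (x \<star> u)" "chord \<gamma> (x \<star> u) y"
proof -
  have *: "u' @ v' \<in> lists \<Sigma> \<and> x \<star> u' \<star> v' = y" if "yields P \<delta> u'" "yields P \<gamma> v'" for u' v'
    using chordD[OF assms(1) yields_Nt[OF assms(2) that]] by simp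
  show "chord \<gamma> (x \<star> u) y" using *[OF assms(3)] by (simp add: chord_def)
  show "chord \<delta> x (x \<star> u)"
    unfolding chord_def
  proof (intro allI impI)
    fix u' assume u': "yields P \<delta> u'"
    have "x \<star> u' = x \<star> u"
      by (rule walk_inj[of _ v]) (use *[OF u' assms(4)] *[OF assms(3,4)] assms(5) in auto)
    then show "u' \<in> lists \<Sigma> \<and> x \<star> u' = x \<star> u" using *[OF u' assms(4)] by simp
  qed
qed

lemma chord_Tm:
  assumes "chord (Tm a # \<gamma>) x y" "yields P \<gamma> v"
  shows "a \<in> \<Sigma>" "chord \<gamma> (x \<cdot> a) y"
  using chordD[OF assms(1) yields_Tm] assms(2) by (auto simp: chord_def)

lemma chord_letter: "a \<in> \<Sigma> \<Longrightarrow> chord [Tm a] x (x \<cdot> a)"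
  by (auto simp: chord_def elim: yields.cases)

text \<open>
  An upper bound for the lengths of the chords of the triangulations, as distances in the graph. It is
  positive so that it bounds the length of a single edge as well.
\<close>

definition mesh :: nat where
  "mesh = (SOME M. 1 \<le> M \<and> (\<forall>\<gamma>\<in>Q. (\<exists>w. yields P \<gamma> w) \<longrightarrow> (\<exists>w. yields P \<gamma> w \<and> length w \<le> M)))"

lemma mesh: "1 \<le> mesh" "\<gamma> \<in> Q \<Longrightarrow> yields P \<gamma> u \<Longrightarrow> \<exists>w. yields P \<gamma> w \<and> length w \<le> mesh"
proof -
  define f where "f \<gamma> = length (SOME w. yields P \<gamma> w)" for \<gamma>
  have "f \<gamma> \<le> Suc (\<Sum>\<gamma>\<in>Q. f \<gamma>)" if "\<gamma> \<in> Q" for \<gamma>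
    using member_le_sum[OF that, of f] finite_Q by simp
  then have "\<exists>M\<ge>1. \<forall>\<gamma>\<in>Q. (\<exists>w. yields P \<gamma> w) \<longrightarrow> (\<exists>w. yields P \<gamma> w \<and> length w \<le> M)"
    by (intro exI[of _ "Suc (\<Sum>\<gamma>\<in>Q. f \<gamma>)"]) (auto simp: f_def intro: someI)
  from someI_ex[OF this] show "1 \<le> mesh"
    "\<gamma> \<in> Q \<Longrightarrow> yields P \<gamma> u \<Longrightarrow> \<exists>w. yields P \<gamma> w \<and> length w \<le> mesh"
    unfolding mesh_def by blast+
qed

lemma chord_short:
  assumes "chord \<gamma> x y" "yields P \<gamma> u" "\<gamma> \<in> Q"
  obtains g where "g \<in> lists \<Sigma>" "length g \<le> mesh" "x \<star> g = y"
  using assms mesh(2) chordD by metis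

lemma chord_lev:
  assumes "chord \<gamma> x y" "yields P \<gamma> u" "\<gamma> \<in> Q" "x \<in> X"
  shows "lev y \<le> lev x + mesh" "lev x \<le> lev y + mesh"
proof -
  obtain g where "g \<in> lists \<Sigma>" "length g \<le> mesh" "x \<star> g = y" using chord_short assms by metis
  then show "lev y \<le> lev x + mesh" "lev x \<le> lev y + mesh"
    using lev_walk_le[of x g] lev_le_walk[of x g] assms by auto
qed

text \<open>
  Every point of a branch that is at most \<open>mesh\<close> higher than the rim is reached from the root by one of these
  words (\<open>near_rim_short\<close>). The factor 5 is the one found in \<open>detour_short\<close>.
\<close>

definition short :: "'s list set" where
  "short = {g \<in> lists \<Sigma>. length g \<le> 5 * mesh}"

lemma finite_short: "finite short"
  unfolding short_def by (rule finite_words)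

lemma Nil_short [simp]: "[] \<in> short"
  by (simp add: short_def)

text \<open>
  The situation met by the smallest chord \<open>y \<rightarrow> y'\<close> that spans a walk \<open>x \<rightarrow> z\<close> inside a branch: \<open>y\<close> lies
  on a geodesic \<open>\<alpha>\<close> from the base point to \<open>x\<close>, \<open>y'\<close> on a geodesic from \<open>z\<close> to the base point, and the middle
  vertex \<open>m\<close> of its triangle lies on the walk, hence at least as high as \<open>x\<close>, and \<open>z\<close> is at
  most \<open>mesh\<close> higher than \<open>x\<close>. As \<open>m\<close> is within \<open>mesh\<close> of \<open>y\<close>
  and of \<open>y'\<close>, the piece of \<open>\<alpha>\<close> has length at most \<open>mesh\<close> and \<open>\<beta>\<close> has length at most \<open>2 * mesh\<close>. The
  detour \<open>x \<rightarrow> y \<rightarrow> m \<rightarrow> y' \<rightarrow> z\<close> then has length at most \<open>5 * mesh\<close>.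
\<close>

lemma detour_short:
  assumes xyz: "x \<in> X" "y \<in> X" "m \<in> X" "y' \<in> X"
    and \<alpha>: "\<alpha> \<in> lists \<Sigma>" "y \<star> \<alpha> = x" "lev y + length \<alpha> = lev x"
    and g: "g \<in> lists \<Sigma>" "length g \<le> mesh" "y \<star> g = m"
    and h: "h \<in> lists \<Sigma>" "length h \<le> mesh" "m \<star> h = y'"
    and \<beta>: "\<beta> \<in> lists \<Sigma>" "z \<in> X" "z \<star> \<beta> = y'" "lev y' + length \<beta> = lev z"
    and lev: "lev x \<le> lev m" "lev z \<le> lev x + mesh"
  obtains k where "k \<in> short" "x \<star> k = z"
proof -
  let ?k = "word_bar bar \<alpha> @ g @ h @ word_bar bar \<beta>"
  have "length \<alpha> \<le> mesh" using lev_walk_le[of y g] xyz g \<alpha> lev by simp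
  moreover have "length \<beta> \<le> 2 * mesh" using lev_le_walk[of m h] xyz h \<beta> lev by simp
  ultimately have "?k \<in> short" using \<alpha> \<beta> g h by (auto simp: short_def)
  moreover have "x \<star> word_bar bar \<alpha> = y" using walk_word_bar[OF xyz(2) \<alpha>(1)] \<alpha>(2) by simp
  moreover have "y' \<star> word_bar bar \<beta> = z" using walk_word_bar[OF \<beta>(2,1)] \<beta>(3) by simp
  ultimately have "?k \<in> short" "x \<star> ?k = z" using g h by auto
  then show ?thesis using that by blast
qed

text \<open>
  Search for the smallest chord that spans the walk \<open>w\<close>: start with the whole closed walk \<open>\<alpha> @ w @ \<beta>\<close>
  and pass to a side of the triangle as long as that side still spans \<open>w\<close>. The two geodesic pieces
  shrink, and the equations between levels and lengths express that they remain geodesic.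
\<close>

lemma short_shortcut_aux:
  assumes "yields P \<gamma> u" "\<gamma> \<in> Q" "u = \<alpha> @ w @ \<beta>" "chord \<gamma> y y'"
    and "x \<in> X" "y \<in> X" "y \<star> \<alpha> = x" "lev y + length \<alpha> = lev x"
    and "stays (lev x) x w" "lev (x \<star> w) \<le> lev x + mesh" "lev y' + length \<beta> = lev (x \<star> w)"
  shows "\<exists>g\<in>short. x \<star> g = x \<star> w"
  using assms
proof (induction arbitrary: \<alpha> w \<beta> y y' rule: yields.induct)
  case yields_Nil
  then show ?case by (intro bexI[of _ "[]"]) auto
next
  case (yields_Tm \<gamma> u a)
  note prems = yields_Tm.prems
  have all: "a # u \<in> lists \<Sigma>" "y \<star> (a # u) = y'"
    using chordD[OF prems(3) yields.yields_Tm[OF yields_Tm.hyps]] by auto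
  have c: "a \<in> \<Sigma>" "chord \<gamma> (y \<cdot> a) y'" using chord_Tm[OF prems(3) yields_Tm.hyps] by auto
  have \<gamma>: "\<gamma> \<in> Q" using prems(1) Q_Cons by blast
  show ?case
  proof (cases \<alpha>)
    case (Cons b \<alpha>')
    with prems(2) have e: "b = a" "u = \<alpha>' @ w @ \<beta>" by auto
    have \<alpha>': "\<alpha>' \<in> lists \<Sigma>" using all e by auto
    have "lev (y \<cdot> a) + length \<alpha>' = lev x"
      using prems(5-7) Cons e c \<alpha>' lev_act_le[of y a] lev_walk_le[of "y \<cdot> a" \<alpha>'] by auto
    then show ?thesis
      using yields_Tm.IH[OF \<gamma> e(2) c(2) prems(4)] prems Cons e c by auto
  next
    case Nil
    show ?thesis
    proof (cases w)
      case Nil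
      then show ?thesis by (intro bexI[of _ "[]"]) auto
    next
      case (Cons b w')
      with \<open>\<alpha> = []\<close> prems(2,6) have e: "b = a" "u = w' @ \<beta>" "y = x" by auto
      obtain h where h: "h \<in> lists \<Sigma>" "length h \<le> mesh" "y \<cdot> a \<star> h = y'"
        using chord_short[OF c(2) yields_Tm.hyps \<gamma>] by blast
      have w: "lev x \<le> lev (x \<cdot> a)" using prems(8) Cons e stays_start[of "lev x" "x \<cdot> a" w'] by simp
      have z: "x \<star> w \<in> X" "x \<star> w \<star> \<beta> = y'" "\<beta> \<in> lists \<Sigma>" using all c e Cons prems(4) by auto
      obtain k where "k \<in> short" "x \<star> k = x \<star> w"
      proof (rule detour_short[of x y "x \<cdot> a" y' \<alpha> "[a]" h \<beta> "x \<star> w"])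
        show "y' \<in> X" using z walk_in by blast
      qed (use z prems e Nil mesh(1) h c w in auto)
      then show ?thesis by blast
    qed
  qed
next
  case (yields_Nt Y \<delta> u1 \<gamma> u2)
  note prems = yields_Nt.prems
  note y1 = yields_Nt.hyps(2) and y2 = yields_Nt.hyps(3)
  have all: "u1 \<in> lists \<Sigma>" "u2 \<in> lists \<Sigma>" "y \<star> u1 \<star> u2 = y'"
    using chordD[OF prems(3) yields.yields_Nt[OF yields_Nt.hyps]] by auto
  have c: "chord \<delta> y (y \<star> u1)" "chord \<gamma> (y \<star> u1) y'"
    using chord_Nt[OF prems(3) yields_Nt.hyps prems(5)] by auto
  have \<gamma>: "\<gamma> \<in> Q" "\<delta> \<in> Q" using prems(1) Q_Cons yields_Nt.hyps by auto
  have m: "y \<star> u1 \<in> X" using walk_in[OF prems(5) all(1)] .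
  have m': "y' \<in> X" using walk_in[OF m all(2)] all(3) by simp
  have "u1 @ u2 \<in> lists \<Sigma>" "y \<star> (u1 @ u2) = y'" using all by auto
  then have lists: "\<alpha> \<in> lists \<Sigma>" "w \<in> lists \<Sigma>" "\<beta> \<in> lists \<Sigma>" "x \<star> w \<star> \<beta> = y'"
    using prems(2,6) unfolding prems(2) by auto
  note lists = lists(1-3) walk_in[OF prems(4) lists(2)] lists(4)
  consider (left) \<alpha>' where "\<alpha> = u1 @ \<alpha>'" "u2 = \<alpha>' @ w @ \<beta>"
    | (mid) w1 w2 where "u1 = \<alpha> @ w1" "w = w1 @ w2" "u2 = w2 @ \<beta>"
    | (right) \<beta>' where "u1 = \<alpha> @ w @ \<beta>'" "\<beta> = \<beta>' @ u2"
    using prems(2) by (auto simp: append_eq_append_conv2)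
  then show ?case
  proof cases
    case left
    have "lev (y \<star> u1) + length \<alpha>' = lev x"
      using prems(5-7) left all lev_walk_le[of y u1] lev_walk_le[of "y \<star> u1" \<alpha>'] m by auto
    then show ?thesis
      using yields_Nt.IH(2)[OF \<gamma>(1) left(2) c(2) prems(4) m(1)] prems left by auto
  next
    case mid
    obtain g where g: "g \<in> lists \<Sigma>" "length g \<le> mesh" "y \<star> g = y \<star> u1"
      using chord_short[OF c(1) y1 \<gamma>(2)] by blast
    obtain h where h: "h \<in> lists \<Sigma>" "length h \<le> mesh" "y \<star> u1 \<star> h = y'"
      using chord_short[OF c(2) y2 \<gamma>(1)] by blast
    have "lev x \<le> lev (y \<star> u1)"
      using prems(6,8) mid by (auto simp: stays_append dest: stays_end)
    then obtain k where "k \<in> short" "x \<star> k = x \<star> w"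
      using detour_short[OF prems(4,5) m m' lists(1) prems(6,7) g h lists(3,4,5)] prems by auto
    then show ?thesis by blast
  next
    case right
    have \<beta>': "\<beta>' \<in> lists \<Sigma>" using all right by auto
    have "y \<star> u1 = x \<star> w \<star> \<beta>'" using right prems by auto
    then have "lev (y \<star> u1) + length \<beta>' = lev (x \<star> w)"
      using prems(10) right all lev_le_walk[of "y \<star> u1" u2] lev_le_walk[of "x \<star> w" \<beta>'] m lists \<beta>' by auto
    then show ?thesis
      using yields_Nt.IH(1)[OF \<gamma>(2) right(1) c(1) prems(4,5,6,7,8,9)] by auto
  qed
qed

text \<open>
  Every walk is part of a closed walk at the base point that is otherwise made of two geodesics; this
  is where the grammar gets hold of walks that start elsewhere.
\<close>

lemma closing:
  assumes "x \<in> X" "w \<in> lists \<Sigma>"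
  obtains \<alpha> \<beta> where "yields P [Nt S] (\<alpha> @ w @ \<beta>)" "base \<star> \<alpha> = x" "length \<alpha> = lev x"
    "length \<beta> = lev (x \<star> w)"
proof -
  obtain \<alpha> where \<alpha>: "\<alpha> \<in> lists \<Sigma>" "length \<alpha> = lev x" "base \<star> \<alpha> = x" using geodesic assms by blast
  have "x \<star> w \<in> X" using assms by simp
  then obtain \<beta> where \<beta>: "\<beta> \<in> lists \<Sigma>" "length \<beta> = lev (x \<star> w)" "base \<star> \<beta> = x \<star> w"
    using geodesic by blast
  have "x \<star> w \<star> word_bar bar \<beta> = base" using walk_word_bar[of base \<beta>] \<beta> by simp
  then have "\<alpha> @ w @ word_bar bar \<beta> \<in> {w. yields P [Nt S] w}"
    unfolding closed_walks using \<alpha> \<beta> assms by auto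
  then show ?thesis using that[of \<alpha> "word_bar bar \<beta>"] \<alpha> \<beta> by simp
qed

text \<open>
  For walks that end on the rim this bounds the diameter of the rim independently of its level, which is why
  there are only finitely many types.
\<close>

lemma short_shortcut:
  assumes "x \<in> X" "stays (lev x) x w" "lev (x \<star> w) \<le> lev x + mesh"
  obtains g where "g \<in> short" "x \<star> g = x \<star> w"
proof -
  obtain \<alpha> \<beta> where "yields P [Nt S] (\<alpha> @ w @ \<beta>)" "base \<star> \<alpha> = x" "length \<alpha> = lev x"
    "length \<beta> = lev (x \<star> w)" using closing assms stays_lists by metis
  then show ?thesis
    using short_shortcut_aux[of "[Nt S]" "\<alpha> @ w @ \<beta>" \<alpha> w \<beta> base base x] chord_start assms that by auto
qed

lemma near_rim_short:
  assumes "x \<in> X" "y \<in> branch x" "lev y \<le> lev x + mesh"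
  obtains g where "g \<in> short" "x \<star> g = y"
  using assms short_shortcut by (metis branchE)

text \<open>
  The finite amount of information about the neighbourhood of the rim that determines the branch: chords
  between points near the rim, the points of the rim, and the edges that leave the branch. Points near the
  rim are named by short words from the root.
\<close>

definition branch_type :: "'x \<Rightarrow> ('s list \<times> 's list \<times> ('n, 's) symbol list) set \<times> 's list set \<times> ('s list \<times> 's) set" where
  "branch_type x =
    ({(g, h, \<gamma>). g \<in> short \<and> h \<in> short \<and> \<gamma> \<in> Q \<and> chord \<gamma> (x \<star> g) (x \<star> h)},
     {g \<in> short. x \<star> g \<in> rim x},
     {(g, s). g \<in> short \<and> s \<in> \<Sigma> \<and> lev x \<le> lev (x \<star> g \<cdot> s)})"

lemma finite_branch_types: "finite (branch_type ` A)"
proof (rule finite_subset)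
  show "branch_type ` A \<subseteq> Pow (short \<times> short \<times> Q) \<times> Pow short \<times> Pow (short \<times> \<Sigma>)"
    by (auto simp: branch_type_def)
qed (use finite_short finite_Q finite_letters in simp)

context
  fixes x x' assumes x: "x \<in> X" "x' \<in> X" and same_type: "branch_type x = branch_type x'"
begin

lemma same_chord:
  assumes "chord \<gamma> (x \<star> g) (x \<star> h)" "g \<in> short" "h \<in> short" "\<gamma> \<in> Q"
  shows "chord \<gamma> (x' \<star> g) (x' \<star> h)"
proof -
  have "(g, h, \<gamma>) \<in> fst (branch_type x)" using assms by (simp add: branch_type_def)
  then show ?thesis unfolding same_type by (simp add: branch_type_def)
qed

lemma same_walk: "chord \<gamma> (x \<star> g) (x \<star> h) \<Longrightarrow> yields P \<gamma> u \<Longrightarrow> g \<in> short \<Longrightarrow> h \<in> short \<Longrightarrow> \<gamma> \<in> Q \<Longrightarrow>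
  x' \<star> g \<star> u = x' \<star> h"
  using same_chord chordD by blast

lemma same_point: "x \<star> g = x \<star> h \<Longrightarrow> g \<in> short \<Longrightarrow> h \<in> short \<Longrightarrow> x' \<star> g = x' \<star> h"
  using same_walk[of "[]" g h "[]"] by simp

text \<open>
  Here the chord \<open>y \<rightarrow> x \<star> h\<close> starts on the geodesic to the root \<open>x\<close> and ends in the branch. If the middle
  vertex of its triangle is on the walk in the branch, it is at most \<open>mesh\<close> higher than \<open>y\<close> and so than \<open>x\<close>,
  and \<open>short_shortcut\<close> gives it a short name \<open>h'\<close>. The second side is then a chord between points near the
  rim, and the type records it. The first side is of the same kind as the given chord and spans less.
\<close>

lemma transfer_left:
  assumes "yields P \<gamma> u" "\<gamma> \<in> Q" "u = \<alpha> @ w" "chord \<gamma> y (x \<star> h)" "h \<in> short"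
    and "y \<in> X" "y \<star> \<alpha> = x" "lev y + length \<alpha> = lev x" "stays (lev x) x w"
  shows "x' \<star> w = x' \<star> h"
  using assms
proof (induction arbitrary: \<alpha> w h y rule: yields.induct)
  case yields_Nil
  then show ?case using same_point[of "[]" h] by simp
next
  case (yields_Tm \<gamma> u a)
  note prems = yields_Tm.prems
  show ?case
  proof (cases \<alpha>)
    case Nil
    then show ?thesis
      using same_walk[of "Tm a # \<gamma>" "[]" h "a # u", OF _ yields.yields_Tm[OF yields_Tm.hyps]] prems by simp
  next
    case (Cons b \<alpha>')
    with prems(2) have e: "b = a" "u = \<alpha>' @ w" by auto
    have c: "a \<in> \<Sigma>" "chord \<gamma> (y \<cdot> a) (x \<star> h)" using chord_Tm[OF prems(3) yields_Tm.hyps] by auto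
    have "u \<in> lists \<Sigma>" using chordD[OF c(2) yields_Tm.hyps] by simp
    then have \<alpha>': "\<alpha>' \<in> lists \<Sigma>" using e by auto
    have "lev (y \<cdot> a) + length \<alpha>' = lev x"
      using prems(5-7) Cons e c \<alpha>' lev_act_le[of y a] lev_walk_le[of "y \<cdot> a" \<alpha>'] by auto
    then show ?thesis
      using yields_Tm.IH[OF _ e(2) c(2) prems(4)] prems Cons e c Q_Cons by auto
  qed
next
  case (yields_Nt Y \<delta> u1 \<gamma> u2)
  note prems = yields_Nt.prems
  note y1 = yields_Nt.hyps(2) and y2 = yields_Nt.hyps(3)
  have c: "chord \<delta> y (y \<star> u1)" "chord \<gamma> (y \<star> u1) (x \<star> h)"
    using chord_Nt[OF prems(3) yields_Nt.hyps prems(5)] by auto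
  have all: "u1 \<in> lists \<Sigma>" "u2 \<in> lists \<Sigma>" using chordD[OF c(1) y1] chordD[OF c(2) y2] by auto
  have \<gamma>: "\<gamma> \<in> Q" "\<delta> \<in> Q" using prems(1) Q_Cons yields_Nt.hyps by auto
  have m: "y \<star> u1 \<in> X" using all prems by auto
  consider (left) \<alpha>' where "\<alpha> = u1 @ \<alpha>'" "u2 = \<alpha>' @ w"
    | (mid) w1 where "u1 = \<alpha> @ w1" "w = w1 @ u2"
    using prems(2) by (auto simp: append_eq_append_conv2)
  then show ?case
  proof cases
    case left
    have "lev (y \<star> u1) + length \<alpha>' = lev x"
      using prems(5-7) left all lev_walk_le[of y u1] lev_walk_le[of "y \<star> u1" \<alpha>'] m by auto
    then show ?thesis
      using yields_Nt.IH(2)[OF \<gamma>(1) left(2) c(2) prems(4) m(1)] prems left by auto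
  next
    case mid
    have w1: "stays (lev x) x w1" "y \<star> u1 = x \<star> w1" using prems(6,8) mid by (auto simp: stays_append)
    have "lev (x \<star> w1) \<le> lev x + mesh" using chord_lev(1)[OF c(1) y1 \<gamma>(2) prems(5)] w1 prems(7) by simp
    then obtain h' where h': "h' \<in> short" "x \<star> h' = y \<star> u1" using short_shortcut[OF x(1) w1(1)] w1(2) by metis
    have "x' \<star> w1 = x' \<star> h'"
      using yields_Nt.IH(1)[OF \<gamma>(2) mid(1) _ h'(1) prems(5,6,7) w1(1)] c(1) h' by simp
    moreover have "x' \<star> h' \<star> u2 = x' \<star> h"
      using same_walk[OF _ y2 h'(1) prems(4) \<gamma>(1)] c(2) h' by simp
    ultimately show ?thesis using mid by simp
  qed
qed

text \<open>
  The mirror image of \<open>transfer_left\<close>: the chord ends on the geodesic from the end of the walk back to the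
  base point.
\<close>

lemma transfer_right:
  assumes "yields P \<gamma> u" "\<gamma> \<in> Q" "u = w @ \<beta>" "chord \<gamma> (x \<star> h) y" "h \<in> short" "x \<star> h \<in> branch x"
    and "stays (lev x) (x \<star> h) w" "x \<star> h \<star> w = x \<star> g" "g \<in> short" "lev (x \<star> g) = lev x"
    "lev y + length \<beta> = lev x"
  shows "x' \<star> h \<star> w = x' \<star> g"
  using assms
proof (induction arbitrary: w \<beta> h y rule: yields.induct)
  case yields_Nil
  then show ?case using same_point[of h g] by simp
next
  case (yields_Tm \<gamma> u a)
  note prems = yields_Tm.prems
  show ?case
  proof (cases w)
    case Nil
    then show ?thesis using same_point[of h g] prems by simp
  next
    case (Cons b w')
    with prems(2) have e: "b = a" "u = w' @ \<beta>" by auto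
    have c: "a \<in> \<Sigma>" "chord \<gamma> (x \<star> h \<cdot> a) y" using chord_Tm[OF prems(3) yields_Tm.hyps] by auto
    have \<gamma>: "\<gamma> \<in> Q" using prems(1) Q_Cons by blast
    have st: "stays (lev x) (x \<star> h \<cdot> a) w'" using prems(6) Cons e by simp
    have br: "x \<star> h \<cdot> a \<in> branch x" using branch_act[OF prems(5) c(1)] stays_start[OF st] by simp
    have "lev (x \<star> h \<cdot> a) \<le> lev x + mesh"
      using chord_lev(2)[OF c(2) yields_Tm.hyps \<gamma>] branch_in[OF br x(1)] prems(10) by simp
    then obtain h' where h': "h' \<in> short" "x \<star> h' = x \<star> h \<cdot> a" using near_rim_short[OF x(1) br] by metis
    have "x' \<star> h' \<star> w' = x' \<star> g"
      using yields_Tm.IH[OF \<gamma> e(2) _ h'(1) _ _ _ prems(8,9,10)] c br st h' prems(7) Cons e by simp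
    moreover have "x' \<star> h \<star> [a] = x' \<star> h'"
      using same_walk[of "[Tm a]" h h' "[a]"] chord_letter c h' prems(4) yields_map_Tm[of P "[a]"] by simp
    ultimately show ?thesis using Cons e by simp
  qed
next
  case (yields_Nt Y \<delta> u1 \<gamma> u2)
  note prems = yields_Nt.prems
  note y1 = yields_Nt.hyps(2) and y2 = yields_Nt.hyps(3)
  have hX: "x \<star> h \<in> X" using branch_in prems(5) x(1) by blast
  have c: "chord \<delta> (x \<star> h) (x \<star> h \<star> u1)" "chord \<gamma> (x \<star> h \<star> u1) y"
    using chord_Nt[OF prems(3) yields_Nt.hyps hX] by auto
  have all: "u1 \<in> lists \<Sigma>" "u2 \<in> lists \<Sigma>" "x \<star> h \<star> u1 \<star> u2 = y"
    using chordD[OF c(1) y1] chordD[OF c(2) y2] by auto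
  have \<gamma>: "\<gamma> \<in> Q" "\<delta> \<in> Q" using prems(1) Q_Cons yields_Nt.hyps by auto
  have m: "x \<star> h \<star> u1 \<in> X" using all hX by auto
  consider (mid) w' where "w = u1 @ w'" "u2 = w' @ \<beta>" | (right) \<beta>' where "u1 = w @ \<beta>'" "\<beta> = \<beta>' @ u2"
    using prems(2) by (auto simp: append_eq_append_conv2)
  then show ?case
  proof cases
    case mid
    have st: "stays (lev x) (x \<star> h) u1" "stays (lev x) (x \<star> h \<star> u1) w'"
      using prems(6) mid by (auto simp: stays_append)
    have br: "x \<star> h \<star> u1 \<in> branch x" using branch_walk[OF prems(5) st(1)] .
    have "lev (x \<star> h \<star> u1) \<le> lev x + mesh"
      using chord_lev(2)[OF c(2) y2 \<gamma>(1) m] prems(10) by simp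
    then obtain h' where h': "h' \<in> short" "x \<star> h' = x \<star> h \<star> u1" using near_rim_short[OF x(1) br] by metis
    have "x' \<star> h' \<star> w' = x' \<star> g"
      using yields_Nt.IH(2)[OF \<gamma>(1) mid(2) _ h'(1) _ _ _ prems(8,9,10)] c br st h' prems(7) mid by simp
    moreover have "x' \<star> h \<star> u1 = x' \<star> h'"
      using same_walk[OF _ y1 prems(4) h'(1) \<gamma>(2)] c(1) h' by simp
    ultimately show ?thesis using mid by simp
  next
    case right
    have l: "\<beta>' \<in> lists \<Sigma>" "w \<in> lists \<Sigma>" using all right by auto
    have e: "x \<star> h \<star> u1 = x \<star> g \<star> \<beta>'" using right prems by auto
    have "x \<star> g \<in> X" using prems(7) hX l by (metis walk_in)
    then have "lev (x \<star> h \<star> u1) + length \<beta>' = lev x"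
      using prems(9,10) right all lev_le_walk[of "x \<star> h \<star> u1" u2] lev_le_walk[of "x \<star> g" \<beta>'] m l e by auto
    then show ?thesis
      using yields_Nt.IH(1)[OF \<gamma>(2) right(1) c(1) prems(4-9)] by simp
  qed
qed

text \<open>
  The chord spans the whole walk. Once the middle vertex of its triangle falls on the walk, the two sides
  are treated by \<open>transfer_left\<close> and \<open>transfer_right\<close>.
\<close>

lemma transfer_both:
  assumes "yields P \<gamma> u" "\<gamma> \<in> Q" "u = \<alpha> @ w @ \<beta>" "chord \<gamma> y y'"
    and "y \<in> X" "y \<star> \<alpha> = x" "lev y + length \<alpha> = lev x" "stays (lev x) x w"
    and "x \<star> w = x \<star> g" "g \<in> short" "lev (x \<star> g) = lev x" "lev y' + length \<beta> = lev x"
  shows "x' \<star> w = x' \<star> g"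
  using assms
proof (induction arbitrary: \<alpha> w \<beta> y y' rule: yields.induct)
  case yields_Nil
  then show ?case using same_point[of "[]" g] by simp
next
  case (yields_Tm \<gamma> u a)
  note prems = yields_Tm.prems
  show ?case
  proof (cases \<alpha>)
    case Nil
    then show ?thesis
      using transfer_right[OF yields.yields_Tm[OF yields_Tm.hyps] prems(1), of w \<beta> "[]" y'] prems by simp
  next
    case (Cons b \<alpha>')
    with prems(2) have e: "b = a" "u = \<alpha>' @ w @ \<beta>" by auto
    have c: "a \<in> \<Sigma>" "chord \<gamma> (y \<cdot> a) y'" using chord_Tm[OF prems(3) yields_Tm.hyps] by auto
    have "u \<in> lists \<Sigma>" using chordD[OF c(2) yields_Tm.hyps] by simp
    then have \<alpha>': "\<alpha>' \<in> lists \<Sigma>" using e by auto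
    have "lev (y \<cdot> a) + length \<alpha>' = lev x"
      using prems(4-6) Cons e c \<alpha>' lev_act_le[of y a] lev_walk_le[of "y \<cdot> a" \<alpha>'] by auto
    then show ?thesis
      using yields_Tm.IH[OF _ e(2) c(2)] prems Cons e c Q_Cons by auto
  qed
next
  case (yields_Nt Y \<delta> u1 \<gamma> u2)
  note prems = yields_Nt.prems
  note y1 = yields_Nt.hyps(2) and y2 = yields_Nt.hyps(3)
  have c: "chord \<delta> y (y \<star> u1)" "chord \<gamma> (y \<star> u1) y'"
    using chord_Nt[OF prems(3) yields_Nt.hyps prems(4)] by auto
  have all: "u1 \<in> lists \<Sigma>" "u2 \<in> lists \<Sigma>" "y \<star> u1 \<star> u2 = y'"
    using chordD[OF c(1) y1] chordD[OF c(2) y2] by auto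
  have \<gamma>: "\<gamma> \<in> Q" "\<delta> \<in> Q" using prems(1) Q_Cons yields_Nt.hyps by auto
  have m: "y \<star> u1 \<in> X" using all prems by auto
  consider (left) \<alpha>' where "\<alpha> = u1 @ \<alpha>'" "u2 = \<alpha>' @ w @ \<beta>"
    | (mid) w1 w2 where "u1 = \<alpha> @ w1" "w = w1 @ w2" "u2 = w2 @ \<beta>"
    | (right) \<beta>' where "u1 = \<alpha> @ w @ \<beta>'" "\<beta> = \<beta>' @ u2"
    using prems(2) by (auto simp: append_eq_append_conv2)
  then show ?case
  proof cases
    case left
    have "lev (y \<star> u1) + length \<alpha>' = lev x"
      using prems(4-6) left all lev_walk_le[of y u1] lev_walk_le[of "y \<star> u1" \<alpha>'] m by auto
    then show ?thesis
      using yields_Nt.IH(2)[OF \<gamma>(1) left(2) c(2) m] prems left by auto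
  next
    case mid
    have w1: "stays (lev x) x w1" "stays (lev x) (x \<star> w1) w2" "y \<star> u1 = x \<star> w1"
      using prems(5,7) mid by (auto simp: stays_append)
    have br: "x \<star> w1 \<in> branch x" using branchI w1 by blast
    have "lev (x \<star> w1) \<le> lev x + mesh" using chord_lev(1)[OF c(1) y1 \<gamma>(2) prems(4)] w1 prems(6) by simp
    then obtain h where h: "h \<in> short" "x \<star> h = x \<star> w1" using short_shortcut[OF x(1) w1(1)] by metis
    have "x' \<star> w1 = x' \<star> h"
      using transfer_left[OF y1 \<gamma>(2) mid(1) _ h(1) prems(4,5,6) w1(1)] c(1) h w1 by simp
    moreover have "x' \<star> h \<star> w2 = x' \<star> g"
      using transfer_right[OF y2 \<gamma>(1) mid(3) _ h(1) _ _ _ prems(9,10,11)] c(2) h w1 br prems(8) mid by simp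
    ultimately show ?thesis using mid by simp
  next
    case right
    have l: "\<beta>' \<in> lists \<Sigma>" "w \<in> lists \<Sigma>" using all right by auto
    have e: "y \<star> u1 = x \<star> w \<star> \<beta>'" using right prems by auto
    have "x \<star> w \<in> X" using l x by simp
    then have "lev (y \<star> u1) + length \<beta>' = lev x"
      using prems(8,10,11) right all lev_le_walk[of "y \<star> u1" u2] lev_le_walk[of "x \<star> w" \<beta>'] m l e by auto
    then show ?thesis
      using yields_Nt.IH(1)[OF \<gamma>(2) right(1) c(1) prems(4-10)] by simp
  qed
qed

text \<open>
  Walks that end on the rim have end points with the same name, in the branch of \<open>x\<close> and from \<open>x'\<close>. The walk
  from \<open>x'\<close> is not yet known to stay in the branch of \<open>x'\<close>; chords are valid wherever their walks go.
\<close>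

lemma transfer:
  assumes "stays (lev x) x w" "x \<star> w = x \<star> g" "g \<in> short" "lev (x \<star> g) = lev x"
  shows "x' \<star> w = x' \<star> g"
proof -
  obtain \<alpha> \<beta> where "yields P [Nt S] (\<alpha> @ w @ \<beta>)" "base \<star> \<alpha> = x" "length \<alpha> = lev x"
    "length \<beta> = lev (x \<star> w)" using closing x assms stays_lists by metis
  then show ?thesis
    using transfer_both[of "[Nt S]" "\<alpha> @ w @ \<beta>" \<alpha> w \<beta> base base g] chord_start assms by auto
qed

lemma transfer_rim:
  assumes "stays (lev x) x w" "lev (x \<star> w) = lev x"
  obtains g where "g \<in> short" "x \<star> w = x \<star> g" "x' \<star> w = x' \<star> g" "x \<star> g \<in> rim x" "x' \<star> g \<in> rim x'"
proof -
  obtain g where g: "g \<in> short" "x \<star> g = x \<star> w" using short_shortcut[OF x(1) assms(1)] assms by auto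
  have 1: "x' \<star> w = x' \<star> g" using transfer[OF assms(1) _ g(1)] g assms by simp
  have 2: "x \<star> g \<in> rim x" using g assms branchI by (simp add: rim_def)
  then have "g \<in> fst (snd (branch_type x))" using g by (simp add: branch_type_def)
  then have "x' \<star> g \<in> rim x'" unfolding same_type by (simp add: branch_type_def)
  then show ?thesis using that 1 2 g by simp
qed

text \<open>
  Two walks with the same end point give a closed walk at the root, and the root is on the rim.
\<close>

lemma transfer_closed:
  assumes "stays (lev x) x v" "stays (lev x) x w" "x \<star> v = x \<star> w"
    "v \<in> lists \<Sigma>" "w \<in> lists \<Sigma>"
  shows "x' \<star> v = x' \<star> w"
proof -
  have "stays (lev x) x (v @ word_bar bar w)"
    using assms stays_word_bar[OF x(1) assms(2)] by (simp add: stays_append)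
  moreover have "x \<star> (v @ word_bar bar w) = x" using assms x by simp
  ultimately have "x' \<star> v \<star> word_bar bar w = x'" using transfer[of "v @ word_bar bar w" "[]"] by simp
  then have "x' \<star> v \<star> word_bar bar w = x' \<star> w \<star> word_bar bar w" using x assms by simp
  then show ?thesis using walk_inj[of "x' \<star> v" "word_bar bar w" "x' \<star> w"] x assms by simp
qed

lemma transfer_exit:
  assumes "g \<in> short" "s \<in> \<Sigma>" "lev x \<le> lev (x \<star> g \<cdot> s)"
  shows "lev x' \<le> lev (x' \<star> g \<cdot> s)"
proof -
  have "(g, s) \<in> snd (snd (branch_type x))" using assms by (simp add: branch_type_def)
  then show ?thesis unfolding same_type by (simp add: branch_type_def)
qed

end

text \<open>
  Look at the first step that would leave the branch of \<open>x'\<close>. It starts on the rim, at a point \<open>x' \<star> g\<close> with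
  \<open>g\<close> short. Up to there both walks stay inside, so \<open>transfer\<close> can be used from \<open>x'\<close> to \<open>x\<close> and the
  walk from \<open>x\<close> is at \<open>x \<star> g\<close>. But the types record which edges leave the branch.
\<close>

lemma transfer_stays:
  assumes x: "x \<in> X" "x' \<in> X" and same: "branch_type x = branch_type x'" and "stays (lev x) x w"
  shows "stays (lev x') x' w"
  using assms(4)
proof (induction w rule: rev_induct)
  case (snoc s w)
  then have w: "stays (lev x) x w" "stays (lev x') x' w" "s \<in> \<Sigma>" "lev x \<le> lev (x \<star> w \<cdot> s)"
    by (auto simp: stays_append)
  have X: "x' \<star> w \<in> X" using w x stays_lists by simp
  have le: "lev x' \<le> lev (x' \<star> w)" using stays_end[OF w(2)] .
  have "lev x' \<le> lev (x' \<star> w \<cdot> s)"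
  proof (cases "lev (x' \<star> w) = lev x'")
    case True
    obtain g where "g \<in> short" "x \<star> w = x \<star> g" "x' \<star> w = x' \<star> g"
      using transfer_rim[OF x(2,1) same[symmetric] w(2) True] by metis
    then show ?thesis using transfer_exit[OF x same _ w(3)] w(4) by simp
  next
    case False
    then show ?thesis using lev_le_act[OF X w(3)] le by linarith
  qed
  then show ?case using w le by (simp add: stays_append)
qed simp

theorem branch_iso_if_same_type:
  assumes x: "x \<in> X" "x' \<in> X" and same: "branch_type x = branch_type x'"
  shows "branch_iso x x'"
proof (rule branch_isoI[OF x])
  note same' = same[symmetric]
  have rim: "lev (x' \<star> w) = lev x'" if "x \<in> X" "x' \<in> X" "branch_type x = branch_type x'"
    "stays (lev x) x w" "lev (x \<star> w) = lev x" for x x' w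
    using transfer_rim[OF that] by (metis (mono_tags, lifting) rim_def mem_Collect_eq)
  show "stays (lev x) x w \<longleftrightarrow> stays (lev x') x' w" for w
    using transfer_stays[OF x same] transfer_stays[OF x(2,1) same'] by blast
  show "x \<star> v = x \<star> w \<longleftrightarrow> x' \<star> v = x' \<star> w" if "stays (lev x) x v" "stays (lev x) x w" for v w
    using transfer_closed[OF x same that] transfer_closed[OF x(2,1) same', of v w]
      that[THEN transfer_stays[OF x same]] that[THEN stays_lists] by blast
  show "lev (x \<star> w) = lev x \<longleftrightarrow> lev (x' \<star> w) = lev x'" if "stays (lev x) x w" for w
    using rim[OF x same that] rim[OF x(2,1) same' transfer_stays[OF x same that]] by blast
qed

end

section \<open>Prefix codes and elements of Thompson's group V\<close>

lemma cone_iff: "\<xi> \<in> cone \<alpha> \<longleftrightarrow> (\<exists>\<eta>. \<xi> = \<alpha> @- \<eta>)"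
  by (auto simp: cone_def)

lemma shift_in_cone [simp]: "\<alpha> @- \<eta> \<in> cone \<alpha>"
  by (auto simp: cone_iff)

lemma cone_Nil [simp]: "cone [] = UNIV"
  by (auto simp: cone_def)

lemma cone_Cons: "\<xi> \<in> cone (b # \<alpha>) \<longleftrightarrow> shd \<xi> = b \<and> stl \<xi> \<in> cone \<alpha>"
  by (cases \<xi>) (auto simp: cone_def)

lemma shift_in_cone_append [simp]: "u @- \<xi> \<in> cone (u @ v) \<longleftrightarrow> \<xi> \<in> cone v"
  by (induction u) (auto simp: cone_Cons)

lemma cone_append_subset: "\<xi> \<in> cone (u @ v) \<Longrightarrow> \<xi> \<in> cone u"
  by (auto simp: cone_iff)

lemma cone_comparable:
  assumes "v @- \<eta> \<in> cone c"
  obtains r where "c = v @ r" | r where "v = c @ r"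
  using assms
proof (induction c arbitrary: v thesis)
  case (Cons b c)
  show ?case
  proof (cases v)
    case (Cons a v')
    then show ?thesis using Cons.IH[of v'] Cons.prems by (auto simp: cone_Cons)
  qed (use Cons in auto)
qed auto

definition complete_code :: "'a set \<Rightarrow> ('a \<Rightarrow> bool list) \<Rightarrow> bool" where
  "complete_code D c \<longleftrightarrow> (\<forall>\<xi>. \<exists>!a. a \<in> D \<and> \<xi> \<in> cone (c a))"

lemma complete_codeE:
  assumes "complete_code D c"
  obtains a where "a \<in> D" "\<xi> \<in> cone (c a)" "\<And>b. b \<in> D \<Longrightarrow> \<xi> \<in> cone (c b) \<Longrightarrow> b = a"
  using assms unfolding complete_code_def by blast

text \<open>
  The code words are \<open>1, 01, 001, \<dots>, 0\<dots>01, 0\<dots>0\<close>, with the last one for \<open>a0\<close>. A single element is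
  encoded by the empty word.
\<close>

lemma complete_code_exists:
  assumes "finite D" "a0 \<in> D"
  shows "\<exists>c. complete_code D c \<and> c a0 \<in> lists {False}"
proof -
  have "finite (D - {a0})" using assms by simp
  then have "\<exists>c. complete_code (insert a0 (D - {a0})) c \<and> c a0 \<in> lists {False}"
  proof (induction "D - {a0}" arbitrary: D rule: finite_induct)
    case empty
    show ?case unfolding empty[symmetric]
      by (intro exI[of _ "\<lambda>_. []"]) (simp add: complete_code_def)
  next
    case (insert b F)
    then obtain c where c: "complete_code (insert a0 F) c" "c a0 \<in> lists {False}"
      by (metis Diff_insert_absorb Diff_iff insertI1 insert_Diff1)
    have b: "b \<noteq> a0" "b \<notin> F" using insert by auto
    let ?c = "\<lambda>a. if a = b then [True] else False # c a"
    have "complete_code (insert a0 (insert b F)) ?c"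
      unfolding complete_code_def
    proof
      fix \<xi> show "\<exists>!a. a \<in> insert a0 (insert b F) \<and> \<xi> \<in> cone (?c a)"
      proof (cases "shd \<xi>")
        case True
        then show ?thesis by (intro ex1I[of _ b]) (auto simp: cone_Cons split: if_splits)
      next
        case False
        obtain a where a: "a \<in> insert a0 F" "stl \<xi> \<in> cone (c a)"
          "\<And>b. b \<in> insert a0 F \<Longrightarrow> stl \<xi> \<in> cone (c b) \<Longrightarrow> b = a"
          using complete_codeE[OF c(1), of "stl \<xi>"] by metis
        show ?thesis
        proof (rule ex1I[of _ a])
          have "a \<noteq> b" using a(1) b by auto
          then show "a \<in> insert a0 (insert b F) \<and> \<xi> \<in> cone (?c a)"
            using a(1,2) False by (simp add: cone_Cons)
        next
          fix e assume e: "e \<in> insert a0 (insert b F) \<and> \<xi> \<in> cone (?c e)"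
          then have "e \<noteq> b" using False by (auto simp: cone_Cons)
          then show "e = a" using e by (intro a(3)) (simp_all add: cone_Cons)
        qed
      qed
    qed
    then show ?case unfolding insert(4)[symmetric] using c b
      by (intro exI[of _ ?c]) auto
  qed
  then show ?thesis using assms insert_Diff[of a0 D] by auto
qed

text \<open>
  The two conditions say that the left sides and the right sides of the rules are prefix partitions and that
  the rules match them bijectively. Stated pointwise they suit rules that are found by parsing a point.
\<close>

lemma Thompson_V_of_rules:
  assumes fin: "finite R"
    and src: "\<And>\<xi>. \<exists>!r. r \<in> R \<and> \<xi> \<in> cone (fst r)"
    and tgt: "\<And>\<xi>. \<exists>!r. r \<in> R \<and> \<xi> \<in> cone (snd r)"
  obtains g where "g \<in> carrier Thompson_V" "\<And>\<alpha> \<beta> \<eta>. (\<alpha>, \<beta>) \<in> R \<Longrightarrow> g (\<alpha> @- \<eta>) = \<beta> @- \<eta>"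
proof -
  have part: "prefix_partition (h ` R)" "inj_on h R"
    if h: "\<And>\<xi>. \<exists>!r. r \<in> R \<and> \<xi> \<in> cone (h r)" for h :: "bool list \<times> bool list \<Rightarrow> bool list"
  proof -
    show "inj_on h R"
    proof
      fix r r' assume "r \<in> R" "r' \<in> R" "h r = h r'"
      then show "r = r'" using h[of "h r @- sconst False"] shift_in_cone by metis
    qed
    have "\<xi> \<in> (\<Union>\<alpha>\<in>h ` R. cone \<alpha>)" for \<xi> using ex1_implies_ex[OF h[of \<xi>]] by blast
    then have "(\<Union>\<alpha>\<in>h ` R. cone \<alpha>) = UNIV" by blast
    moreover have "disjoint_family_on cone (h ` R)"
    proof -
      have "h r = h r'" if "r \<in> R" "r' \<in> R" "\<xi> \<in> cone (h r)" "\<xi> \<in> cone (h r')" for r r' \<xi>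
        using h[of \<xi>] that by metis
      then show ?thesis by (fastforce simp: disjoint_family_on_def)
    qed
    ultimately show "prefix_partition (h ` R)" using fin by (simp add: prefix_partition_def)
  qed
  note A = part[of fst, OF src] and B = part[of snd, OF tgt]
  define f where "f = snd \<circ> inv_into R fst"
  have f: "f \<alpha> = \<beta>" if "(\<alpha>, \<beta>) \<in> R" for \<alpha> \<beta>
    using inv_into_f_f[OF A(2) that] by (simp add: f_def)
  have bij: "bij_betw f (fst ` R) (snd ` R)"
    unfolding f_def by (rule bij_betw_trans[OF bij_betw_inv_into inj_on_imp_bij_betw])
      (use A B in \<open>auto intro: inj_on_imp_bij_betw\<close>)
  define g where "g \<xi> = (let r = THE r. r \<in> R \<and> \<xi> \<in> cone (fst r) in snd r @- sdrop (length (fst r)) \<xi>)" for \<xi>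
  have g: "g (\<alpha> @- \<eta>) = \<beta> @- \<eta>" if "(\<alpha>, \<beta>) \<in> R" for \<alpha> \<beta> \<eta>
  proof -
    have "(THE r. r \<in> R \<and> \<alpha> @- \<eta> \<in> cone (fst r)) = (\<alpha>, \<beta>)"
      by (rule the1_equality[OF src]) (simp add: that)
    then show ?thesis by (simp add: g_def sdrop_shift)
  qed
  have "induces (fst ` R) f g" using f g by (auto simp: induces_def)
  then have "g \<in> carrier Thompson_V" using A(1) B(1) bij by (auto simp: Thompson_V_def)
  then show ?thesis using g that by blast
qed


text \<open>
  Refining the prefix partition, all the words of one sufficiently large length can be used as the domain.
\<close>

lemma Thompson_V_uniform:
  assumes "g \<in> carrier Thompson_V"
  shows "bij g" "\<exists>N f. \<forall>\<alpha>. length \<alpha> = N \<longrightarrow> (\<forall>\<eta>. g (\<alpha> @- \<eta>) = f \<alpha> @- \<eta>)"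
proof -
  obtain A B f where A: "prefix_partition A" and B: "prefix_partition B"
    and f: "bij_betw f A B" and "induces A f g"
    using assms by (auto simp: Thompson_V_def)
  then have g: "g (\<alpha> @- \<eta>) = f \<alpha> @- \<eta>" if "\<alpha> \<in> A" for \<alpha> \<eta> using that by (simp add: induces_def)
  have cover: "\<exists>\<alpha>\<in>D. \<exists>\<eta>. \<xi> = \<alpha> @- \<eta>" if "prefix_partition D" for D \<xi>
  proof -
    have "\<xi> \<in> (\<Union>\<alpha>\<in>D. cone \<alpha>)" using that by (simp add: prefix_partition_def)
    then show ?thesis by (simp add: cone_iff)
  qed
  show "bij g"
  proof (rule bijI)
    show "inj g"
    proof
      fix \<xi> \<zeta> assume eq: "g \<xi> = g \<zeta>"
      obtain \<alpha> \<eta> where 1: "\<alpha> \<in> A" "\<xi> = \<alpha> @- \<eta>" using cover[OF A] by blast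
      obtain \<beta> \<theta> where 2: "\<beta> \<in> A" "\<zeta> = \<beta> @- \<theta>" using cover[OF A] by blast
      have e: "f \<alpha> @- \<eta> = f \<beta> @- \<theta>" using eq g 1 2 by simp
      then have "f \<alpha> @- \<eta> \<in> cone (f \<alpha>) \<inter> cone (f \<beta>)" by (metis IntI shift_in_cone)
      moreover have "f \<alpha> \<in> B" "f \<beta> \<in> B" using f 1 2 by (auto simp: bij_betw_def)
      ultimately have "f \<alpha> = f \<beta>" using B unfolding prefix_partition_def disjoint_family_on_def by blast
      then have "\<alpha> = \<beta>" using f 1 2 by (auto simp: bij_betw_def inj_on_def)
      then show "\<xi> = \<zeta>" using e 1 2 by simp
    qed
    show "surj g"
      unfolding surj_def
    proof
      fix \<xi>
      obtain \<beta> \<eta> where "\<beta> \<in> B" "\<xi> = \<beta> @- \<eta>" using cover[OF B] by blast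
      moreover obtain \<alpha> where "\<alpha> \<in> A" "f \<alpha> = \<beta>" using f calculation by (auto simp: bij_betw_def)
      ultimately have "\<xi> = g (\<alpha> @- \<eta>)" using g by simp
      then show "\<exists>\<zeta>. \<xi> = g \<zeta>" by blast
    qed
  qed
  define N where "N = Max (insert 0 (length ` A))"
  have fin: "finite A" using A by (simp add: prefix_partition_def)
  have "\<exists>\<beta>. \<forall>\<eta>. g (\<alpha> @- \<eta>) = \<beta> @- \<eta>" if len: "length \<alpha> = N" for \<alpha>
  proof -
    obtain a where a: "a \<in> A" "\<alpha> @- sconst False \<in> cone a" using cover[OF A] by (auto simp: cone_iff)
    have "length a \<le> length \<alpha>" unfolding len N_def using fin a by (intro Max_ge) auto
    with a(2) obtain r where "\<alpha> = a @ r" by (cases rule: cone_comparable) auto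
    then show ?thesis using g[OF a(1)] by (intro exI[of _ "f a @ r"]) simp
  qed
  then show "\<exists>N f. \<forall>\<alpha>. length \<alpha> = N \<longrightarrow> (\<forall>\<eta>. g (\<alpha> @- \<eta>) = f \<alpha> @- \<eta>)" by metis
qed

lemma stake_shift_length [simp]: "length \<alpha> = n \<Longrightarrow> stake n (\<alpha> @- \<eta>) = \<alpha>"
  by (simp add: stake_shift)

lemma Thompson_V_uniformI:
  assumes "bij g" and f: "\<And>\<alpha> \<eta>. length \<alpha> = N \<Longrightarrow> g (\<alpha> @- \<eta>) = f \<alpha> @- \<eta>"
  shows "g \<in> carrier Thompson_V"
proof -
  define R where "R = (\<lambda>\<alpha>. (\<alpha>, f \<alpha>)) ` {\<alpha>. length \<alpha> = N}"
  have dec: "g \<xi> = f (stake N \<xi>) @- sdrop N \<xi>" for \<xi>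
    using f[of "stake N \<xi>" "sdrop N \<xi>"] by (simp add: stake_sdrop)
  have fin: "finite R" using finite_lists_length_eq[of "UNIV :: bool set" N] by (simp add: R_def)
  have src: "\<exists>!r. r \<in> R \<and> \<xi> \<in> cone (fst r)" for \<xi>
  proof (rule ex1I[of _ "(stake N \<xi>, f (stake N \<xi>))"])
    show "(stake N \<xi>, f (stake N \<xi>)) \<in> R \<and> \<xi> \<in> cone (fst (stake N \<xi>, f (stake N \<xi>)))"
      using shift_in_cone[of "stake N \<xi>" "sdrop N \<xi>"] by (simp add: R_def stake_sdrop)
    show "r = (stake N \<xi>, f (stake N \<xi>))" if "r \<in> R \<and> \<xi> \<in> cone (fst r)" for r
      using that by (auto simp: R_def cone_iff)
  qed
  have tgt: "\<exists>!r. r \<in> R \<and> \<xi> \<in> cone (snd r)" for \<xi>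
  proof -
    obtain \<zeta> where \<zeta>: "\<xi> = g \<zeta>" using assms(1) by (metis bij_pointE)
    show ?thesis
    proof (rule ex1I[of _ "(stake N \<zeta>, f (stake N \<zeta>))"])
      show "(stake N \<zeta>, f (stake N \<zeta>)) \<in> R \<and> \<xi> \<in> cone (snd (stake N \<zeta>, f (stake N \<zeta>)))"
        by (simp add: R_def dec \<zeta>)
      fix r assume "r \<in> R \<and> \<xi> \<in> cone (snd r)"
      then obtain \<alpha> \<eta> where r: "r = (\<alpha>, f \<alpha>)" "length \<alpha> = N" "\<xi> = f \<alpha> @- \<eta>"
        by (auto simp: R_def cone_iff)
      then have "g (\<alpha> @- \<eta>) = g \<zeta>" using f \<zeta> by simp
      then have "\<alpha> @- \<eta> = \<zeta>" using assms(1) by (simp add: bij_is_inj inj_eq)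
      then show "r = (stake N \<zeta>, f (stake N \<zeta>))" using r by auto
    qed
  qed
  obtain h where h: "h \<in> carrier Thompson_V" "\<And>\<alpha> \<beta> \<eta>. (\<alpha>, \<beta>) \<in> R \<Longrightarrow> h (\<alpha> @- \<eta>) = \<beta> @- \<eta>"
    using Thompson_V_of_rules[OF fin src tgt] by blast
  have "h \<xi> = g \<xi>" for \<xi>
    using h(2)[of "stake N \<xi>" "f (stake N \<xi>)" "sdrop N \<xi>"] by (simp add: R_def dec stake_sdrop)
  then have "h = g" by blast
  then show ?thesis using h by simp
qed

lemma id_Thompson_V: "id \<in> carrier Thompson_V"
  by (rule Thompson_V_uniformI[of _ 0 id]) auto

lemma comp_Thompson_V:
  assumes "g \<in> carrier Thompson_V" "h \<in> carrier Thompson_V"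
  shows "h \<circ> g \<in> carrier Thompson_V"
proof -
  obtain N f where f: "\<And>\<alpha> \<eta>. length \<alpha> = N \<Longrightarrow> g (\<alpha> @- \<eta>) = f \<alpha> @- \<eta>"
    using Thompson_V_uniform(2)[OF assms(1)] by blast
  obtain M k where k: "\<And>\<alpha> \<eta>. length \<alpha> = M \<Longrightarrow> h (\<alpha> @- \<eta>) = k \<alpha> @- \<eta>"
    using Thompson_V_uniform(2)[OF assms(2)] by blast
  have k': "h (\<beta> @- \<eta>) = (k (take M \<beta>) @ drop M \<beta>) @- \<eta>" if "M \<le> length \<beta>" for \<beta> \<eta>
    using k[of "take M \<beta>" "drop M \<beta> @- \<eta>"] that by (simp flip: shift_append)
  define l where "l \<alpha> = (let \<beta> = f (take N \<alpha>) @ drop N \<alpha> in k (take M \<beta>) @ drop M \<beta>)" for \<alpha>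
  show ?thesis
  proof (rule Thompson_V_uniformI[of _ "N + M" l])
    show "bij (h \<circ> g)" using assms Thompson_V_uniform(1) bij_comp by blast
    fix \<alpha> :: "bool list" and \<eta> assume len: "length \<alpha> = N + M"
    let ?\<beta> = "f (take N \<alpha>) @ drop N \<alpha>"
    have "g (\<alpha> @- \<eta>) = ?\<beta> @- \<eta>" using f[of "take N \<alpha>" "drop N \<alpha> @- \<eta>"] len by (simp flip: shift_append)
    moreover have "h (?\<beta> @- \<eta>) = (k (take M ?\<beta>) @ drop M ?\<beta>) @- \<eta>"
      by (rule k') (use len in simp)
    ultimately show "(h \<circ> g) (\<alpha> @- \<eta>) = l \<alpha> @- \<eta>" by (simp add: l_def Let_def)
  qed
qed

lemma Thompson_V_continuous:
  assumes "g \<in> carrier Thompson_V"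
  shows "\<exists>m. \<forall>k\<ge>m. \<forall>\<xi> \<zeta>. stake k \<xi> = stake k \<zeta> \<longrightarrow> stake n (g \<xi>) = stake n (g \<zeta>)"
proof -
  obtain N f where f: "\<And>\<alpha> \<eta>. length \<alpha> = N \<Longrightarrow> g (\<alpha> @- \<eta>) = f \<alpha> @- \<eta>"
    using Thompson_V_uniform(2)[OF assms] by blast
  have dec: "stake n (g \<xi>) = take n (f (stake N \<xi>) @ stake n (sdrop N \<xi>))" for \<xi>
    using f[of "stake N \<xi>" "sdrop N \<xi>"] by (simp add: stake_sdrop stake_shift take_stake min_def)
  show ?thesis
  proof (intro exI[of _ "N + n"] allI impI)
    fix k and \<xi> \<zeta> :: "bool stream" assume k: "N + n \<le> k" and eq: "stake k \<xi> = stake k \<zeta>"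
    have "stake N \<xi> = stake N \<zeta>" using arg_cong[OF eq, of "take N"] k by (simp add: take_stake min_def)
    moreover have "n \<le> k - N" using k by simp
    then have "stake n (sdrop N \<xi>) = stake n (sdrop N \<zeta>)"
      using arg_cong[OF eq, of "\<lambda>u. take n (drop N u)"] by (simp add: take_stake drop_stake min_def)
    ultimately show "stake n (g \<xi>) = stake n (g \<zeta>)" by (simp add: dec)
  qed
qed

text \<open>
  By continuity: an initial segment of the image depends only on an initial segment of the argument.
\<close>

lemma Thompson_V_eq_if_dense:
  assumes "g \<in> carrier Thompson_V" "h \<in> carrier Thompson_V"
    and dense: "\<And>v. \<exists>\<xi>\<in>cone v. g \<xi> = h \<xi>"
  shows "g = h"
proof
  fix \<xi>
  have "g \<xi> !! n = h \<xi> !! n" for n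
  proof -
    obtain m where m: "\<And>k \<xi> \<zeta>. m \<le> k \<Longrightarrow> stake k \<xi> = stake k \<zeta> \<Longrightarrow> stake (Suc n) (g \<xi>) = stake (Suc n) (g \<zeta>)"
      using Thompson_V_continuous[OF assms(1)] by metis
    obtain l where l: "\<And>k \<xi> \<zeta>. l \<le> k \<Longrightarrow> stake k \<xi> = stake k \<zeta> \<Longrightarrow> stake (Suc n) (h \<xi>) = stake (Suc n) (h \<zeta>)"
      using Thompson_V_continuous[OF assms(2)] by metis
    obtain \<zeta> where \<zeta>: "\<zeta> \<in> cone (stake (m + l) \<xi>)" "g \<zeta> = h \<zeta>" using dense by blast
    then have "stake (m + l) \<xi> = stake (m + l) \<zeta>" by (auto simp: cone_iff)
    then have "stake (Suc n) (g \<xi>) = stake (Suc n) (h \<xi>)"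
      using m[of "m + l" \<xi> \<zeta>] l[of "m + l" \<xi> \<zeta>] \<zeta>(2) by simp
    then show ?thesis using stake_nth[of n "Suc n"] by (metis lessI)
  qed
  then have "snth (g \<xi>) = snth (h \<xi>)" by blast
  then show "g \<xi> = h \<xi>" using stream_smap_nats by metis
qed

section \<open>Addresses of the points of a graph with finitely many branch types\<close>

context schreier_graph
begin

text \<open>
  The graph of the rooted isomorphism from the branch of \<open>x\<close> to the branch of \<open>x'\<close>.
\<close>

definition corr :: "'x \<Rightarrow> 'x \<Rightarrow> 'x \<Rightarrow> 'x \<Rightarrow> bool" where
  "corr x x' z z' \<longleftrightarrow> (\<exists>v. stays (lev x) x v \<and> z = x \<star> v \<and> z' = x' \<star> v)"

lemma corr_left: "corr x x' z z' \<Longrightarrow> z \<in> branch x"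
  by (auto simp: corr_def branch_def)

lemma corr_total: "z \<in> branch x \<Longrightarrow> \<exists>z'. corr x x' z z'"
  by (auto simp: corr_def branch_def)

context
  fixes x x' assumes xX: "x \<in> X" and iso: "branch_iso x x'"
begin

lemma iso_stays: "stays (lev x) x w \<longleftrightarrow> stays (lev x') x' w"
  using iso by (simp add: branch_iso_def)

lemma iso_eq: "stays (lev x) x v \<Longrightarrow> stays (lev x) x w \<Longrightarrow> x \<star> v = x \<star> w \<longleftrightarrow> x' \<star> v = x' \<star> w"
  using iso unfolding branch_iso_def by blast

lemma corr_right: "corr x x' z z' \<Longrightarrow> z' \<in> branch x'"
  using iso_stays by (auto simp: corr_def branch_def)

lemma corr_surj: "z' \<in> branch x' \<Longrightarrow> \<exists>z. corr x x' z z'"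
  using iso_stays by (auto simp: corr_def branch_def)

lemma corr_unique: "corr x x' z z' \<Longrightarrow> corr x x' u u' \<Longrightarrow> z = u \<longleftrightarrow> z' = u'"
  using iso_eq by (auto simp: corr_def)

lemma corr_lev: "corr x x' z z' \<Longrightarrow> lev z + lev x' = lev z' + lev x"
  using iso by (auto simp: corr_def branch_iso_def)

lemma corr_act:
  assumes "corr x x' z z'" "s \<in> \<Sigma>"
  shows "lev x \<le> lev (z \<cdot> s) \<longleftrightarrow> lev x' \<le> lev (z' \<cdot> s)"
    "lev x \<le> lev (z \<cdot> s) \<Longrightarrow> corr x x' (z \<cdot> s) (z' \<cdot> s)"
proof -
  obtain v where v: "stays (lev x) x v" "z = x \<star> v" "z' = x' \<star> v" using assms by (auto simp: corr_def)
  have 1: "lev x \<le> lev (z \<cdot> s) \<longleftrightarrow> stays (lev x) x (v @ [s])"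
    using v assms stays_end[OF v(1)] by (simp add: stays_append)
  have 2: "lev x' \<le> lev (z' \<cdot> s) \<longleftrightarrow> stays (lev x') x' (v @ [s])"
    using v assms iso_stays[of v] stays_end[of "lev x'" x' v] by (simp add: stays_append)
  show "lev x \<le> lev (z \<cdot> s) \<longleftrightarrow> lev x' \<le> lev (z' \<cdot> s)" using 1 2 iso_stays by simp
  show "corr x x' (z \<cdot> s) (z' \<cdot> s)" if "lev x \<le> lev (z \<cdot> s)"
    using that 1 v unfolding corr_def by (intro exI[of _ "v @ [s]"]) simp
qed

end

text \<open>
  The whole graph is the only branch that no edge leaves, and isomorphisms respect leaving edges.
\<close>

lemma branch_iso_base:
  assumes "x \<in> X" "branch_iso x base"
  shows "x = base"
proof -
  obtain v where v: "stays 0 x v" "lev (x \<star> v) = 0" using descent[of x 0] assms by auto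
  then have "stays (lev x) x v" using assms unfolding branch_iso_def by (auto simp: stays_0)
  then have "lev x \<le> 0" using stays_end v(2) by metis
  then show ?thesis using lev_eq_0 assms by simp
qed

text \<open>
  A root of the branch of \<open>y\<close> that depends on the branch only.
\<close>

definition anchor :: "'x \<Rightarrow> 'x" where
  "anchor y = (SOME z. z \<in> X \<and> branch z = branch y)"

lemma anchor:
  assumes "y \<in> X"
  shows "anchor y \<in> X" "branch (anchor y) = branch y" "lev (anchor y) = lev y"
proof -
  show *: "anchor y \<in> X" "branch (anchor y) = branch y"
    using someI[of "\<lambda>z. z \<in> X \<and> branch z = branch y" y] assms by (auto simp: anchor_def)
  then have "anchor y \<in> branch y" "y \<in> branch (anchor y)" by (metis branch_self)+
  then show "lev (anchor y) = lev y" using branch_lev by (simp add: order.antisym)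
qed

lemma anchor_cong: "branch x = branch y \<Longrightarrow> anchor x = anchor y"
  by (simp add: anchor_def)

definition child :: "'x \<Rightarrow> 'x \<Rightarrow> bool" where
  "child t y \<longleftrightarrow> y \<in> branch t \<and> lev y = Suc (lev t) \<and> anchor y = y"

lemma child_unique:
  assumes "t \<in> X" "child t y" "child t y'" "z \<in> branch y" "z \<in> branch y'"
  shows "y = y'"
proof -
  have "branch y = branch y'"
    by (rule branch_eqI[OF _ _ assms(4,5)]) (use assms branch_in in \<open>auto simp: child_def\<close>)
  then show ?thesis using anchor_cong assms unfolding child_def by metis
qed

lemma child_exists:
  assumes "t \<in> X" "z \<in> branch t" "lev t < lev z"
  obtains y where "child t y" "z \<in> branch y"
proof -
  have z: "z \<in> X" using branch_in assms by blast
  obtain v where v: "stays (Suc (lev t)) z v" "lev (z \<star> v) = Suc (lev t)"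
    using descent[OF z, of "Suc (lev t)"] assms by auto
  let ?q = "z \<star> v"
  have q: "?q \<in> branch t" using branch_walk[OF assms(2)] stays_mono[OF v(1)] by simp
  have qX: "?q \<in> X" using branch_in q assms by blast
  have "stays (lev ?q) ?q (word_bar bar v)" using stays_word_bar[OF z v(1)] v by simp
  moreover have "?q \<star> word_bar bar v = z" using z stays_lists[OF v(1)] by simp
  ultimately have "z \<in> branch ?q" using branchI by metis
  moreover have "child t (anchor ?q)"
    unfolding child_def
  proof (intro conjI)
    have "anchor ?q \<in> branch ?q" using anchor[OF qX] branch_self by metis
    then show "anchor ?q \<in> branch t" using branch_trans q by blast
    show "anchor (anchor ?q) = anchor ?q" using anchor_cong[OF anchor(2)[OF qX]] .
  qed (use anchor[OF qX] v in simp)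
  ultimately show ?thesis using that anchor[OF qX] by metis
qed

lemma finite_children: "t \<in> X \<Longrightarrow> finite {y. child t y}"
  by (rule finite_subset[OF _ finite_ball[of "Suc (lev t)"]]) (use branch_in in \<open>auto simp: child_def\<close>)

lemma finite_rim: "t \<in> X \<Longrightarrow> finite (rim t)"
  by (rule finite_subset[OF _ finite_ball[of "lev t"]]) (use branch_in in \<open>auto simp: rim_def\<close>)

lemma child_in: "child t y \<Longrightarrow> t \<in> X \<Longrightarrow> y \<in> X"
  using branch_in by (auto simp: child_def)

lemma child_branch: "child t y \<Longrightarrow> z \<in> branch y \<Longrightarrow> z \<in> branch t"
  using branch_trans by (auto simp: child_def)

lemma rim_base [simp]: "rim base = {base}"
  using lev_eq_0 by (auto simp: rim_def)

end

text \<open>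
  Schreier graphs with finitely many branches up to isomorphism; \<open>rep x\<close> is the root of the chosen
  branch isomorphic to the branch of \<open>x\<close>.
\<close>

locale tree_like_graph = schreier_graph X \<Sigma> act bar base
  for X :: "'x set" and \<Sigma> :: "'s set" and act :: "'x \<Rightarrow> 's \<Rightarrow> 'x" (infixl "\<cdot>" 70)
    and bar :: "'s \<Rightarrow> 's" and base :: 'x +
  fixes rep :: "'x \<Rightarrow> 'x"
  assumes rep_in: "x \<in> X \<Longrightarrow> rep x \<in> X"
    and rep_iso: "x \<in> X \<Longrightarrow> branch_iso x (rep x)"
    and finite_rep: "finite (rep ` X)"
begin

text \<open>
  Only those representatives that can be reached from the whole graph by passing to child branches occur in
  addresses. Restricting to them makes addresses dense: an unreachable type would code for no point.
\<close>

inductive_set types :: "'x set" where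
  base_types [simp]: "base \<in> types"
| rep_types: "t \<in> types \<Longrightarrow> child t y \<Longrightarrow> rep y \<in> types"

lemma types_in: "t \<in> types \<Longrightarrow> t \<in> X"
  by (induction rule: types.induct) (auto intro: rep_in child_in)

lemma finite_types: "finite types"
proof (rule finite_subset)
  show "types \<subseteq> insert base (rep ` X)"
  proof
    fix t assume "t \<in> types" then show "t \<in> insert base (rep ` X)"
      by cases (use child_in types_in in auto)
  qed
qed (use finite_rep in simp)

text \<open>
  An edge \<open>(t, y)\<close> says that the representative branch \<open>t\<close> has the child \<open>y\<close>, of type \<open>rep y\<close>. An address
  is read from the top of the store, that is, against the direction of edges. So the edges with
  a given target need a common code.
\<close>

definition edges_to :: "'x \<Rightarrow> ('x \<times> 'x) set" where
  "edges_to t' = {(t, y). t \<in> types \<and> child t y \<and> rep y = t'}"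

lemma finite_edges_to: "finite (edges_to t')"
proof (rule finite_subset)
  show "edges_to t' \<subseteq> (SIGMA t:types. {y. child t y})" by (auto simp: edges_to_def)
qed (use finite_types types_in finite_children in auto)

lemma edges_to_nonempty: "t \<in> types \<Longrightarrow> t \<noteq> base \<Longrightarrow> edges_to t \<noteq> {}"
  by (erule types.cases) (auto simp: edges_to_def)

lemma rep_child_not_base: "t \<in> types \<Longrightarrow> child t y \<Longrightarrow> rep y \<noteq> base"
proof
  assume a: "t \<in> types" "child t y" "rep y = base"
  then have "y \<in> X" using child_in types_in by blast
  then have "y = base" using branch_iso_base rep_iso[of y] a by simp
  then show False using a by (simp add: child_def)
qed

definition corners :: "('x \<times> 'x) set" where
  "corners = (SIGMA t:types. rim t)"

lemma finite_corners: "finite corners"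
  unfolding corners_def using finite_types types_in finite_rim by auto

definition corner_code :: "'x \<times> 'x \<Rightarrow> bool list" where
  "corner_code = (SOME c. complete_code corners c \<and> c (base, base) \<in> lists {False})"

lemma corner_code: "complete_code corners corner_code" "corner_code (base, base) \<in> lists {False}"
proof -
  have "\<exists>c. complete_code corners c \<and> c (base, base) \<in> lists {False}"
    using complete_code_exists[OF finite_corners, of "(base, base)"] by (auto simp: corners_def)
  from someI_ex[OF this] show "complete_code corners corner_code" "corner_code (base, base) \<in> lists {False}"
    by (simp_all add: corner_code_def)
qed

definition edge_code :: "'x \<Rightarrow> 'x \<times> 'x \<Rightarrow> bool list" where
  "edge_code t = (SOME c. complete_code (edges_to t) c)"

lemma edge_code:
  assumes "t \<in> types" "t \<noteq> base"
  shows "complete_code (edges_to t) (edge_code t)"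
    "e \<in> edges_to t \<Longrightarrow> edge_code t e = [] \<Longrightarrow> edges_to t = {e}"
proof -
  obtain e0 where "e0 \<in> edges_to t" using edges_to_nonempty assms by blast
  from complete_code_exists[OF finite_edges_to this]
  have "\<exists>c. complete_code (edges_to t) c" by blast
  from someI_ex[OF this] show c: "complete_code (edges_to t) (edge_code t)"
    unfolding edge_code_def[symmetric] .
  assume e: "e \<in> edges_to t" "edge_code t e = []"
  have "e' = e" if e': "e' \<in> edges_to t" for e'
  proof -
    \<comment> \<open>a word starting with the code word of \<open>e'\<close> also starts with the empty one\<close>
    obtain b where "\<And>a. a \<in> edges_to t \<Longrightarrow> edge_code t e' @- sconst False \<in> cone (edge_code t a) \<Longrightarrow> a = b"
      using complete_codeE[OF c] by metis
    then show ?thesis using e e' by (metis UNIV_I cone_Nil shift_in_cone)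
  qed
  then show "edges_to t = {e}" using e by blast
qed

text \<open>
  \<open>enc t z w\<close>: the word \<open>w\<close> describes the position of \<open>z\<close> in the representative branch \<open>t\<close>. A point beyond
  the rim lies in a child branch \<open>y\<close>; its counterpart \<open>z'\<close> in the representative \<open>rep y\<close> is described first,
  followed by the edge from \<open>t\<close>, which is thus deeper in the store. The whole graph is the branch \<open>base\<close>.
\<close>

inductive enc :: "'x \<Rightarrow> 'x \<Rightarrow> bool list \<Rightarrow> bool" where
  enc_rim: "t \<in> types \<Longrightarrow> p \<in> rim t \<Longrightarrow> enc t p (corner_code (t, p))"
| enc_child: "t \<in> types \<Longrightarrow> child t y \<Longrightarrow> corr y (rep y) z z' \<Longrightarrow> enc (rep y) z' w \<Longrightarrow>
    enc t z (w @ edge_code (rep y) (t, y))"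

lemma child_rep:
  assumes "t \<in> types" "child t y"
  shows "t \<in> X" "y \<in> X" "branch_iso y (rep y)" "rep y \<in> types" "lev y = Suc (lev t)"
  using assms child_in types_in rep_iso rep_types by (auto simp: child_def)

lemma enc_branch: "enc t z w \<Longrightarrow> t \<in> types \<and> z \<in> branch t"
  by (induction rule: enc.induct) (auto simp: rim_def intro: child_branch corr_left)

lemma enc_rim_eq:
  assumes "enc t z w" "lev z = lev t"
  shows "w = corner_code (t, z)"
  using assms(1)
proof cases
  case (enc_child y z' w')
  then have "lev y \<le> lev z" using corr_left branch_lev by blast
  then show ?thesis using child_rep[OF enc_child(2,3)] assms by simp
qed simp

lemma enc_total:
  assumes "t \<in> types" "z \<in> branch t"
  shows "\<exists>w. enc t z w"
  using assms
proof (induction "lev z - lev t" arbitrary: t z rule: less_induct)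
  case less
  show ?case
  proof (cases "lev z = lev t")
    case True
    then show ?thesis using less enc_rim by (auto simp: rim_def)
  next
    case False
    then have l: "lev t < lev z" using branch_lev less by (simp add: le_neq_implies_less)
    then obtain y where y: "child t y" "z \<in> branch y" using child_exists types_in less by metis
    note c = child_rep[OF less(2) y(1)]
    obtain z' where z': "corr y (rep y) z z'" using corr_total y by blast
    have "z' \<in> branch (rep y)" "lev z + lev (rep y) = lev z' + lev y"
      using corr_right[OF c(2,3) z'] corr_lev[OF c(2,3) z'] .
    moreover from this(2) have "lev z' - lev (rep y) < lev z - lev t" using c(5) l by linarith
    ultimately obtain w where "enc (rep y) z' w" using less(1)[of z' "rep y"] c(4) by blast
    then show ?thesis using enc_child[OF less(2) y(1) z'] by blast
  qed
qed

lemma enc_unique: "enc t z w \<Longrightarrow> enc t z w' \<Longrightarrow> w = w'"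
proof (induction arbitrary: w' rule: enc.induct)
  case (enc_rim t p)
  then show ?case using enc_rim_eq by (auto simp: rim_def)
next
  case (enc_child t y z z' w)
  note c = child_rep[OF enc_child(1,2)]
  have z: "z \<in> branch y" using corr_left enc_child by blast
  from enc_child(6) show ?case
  proof cases
    case enc_rim
    then show ?thesis using branch_lev[OF z] c by (simp add: rim_def)
  next
    case (enc_child y1 z1 w1)
    have [simp]: "y1 = y" using child_unique[OF c(1) enc_child(3) \<open>child t y\<close> corr_left[OF enc_child(4)] z] .
    have "z1 = z'" using corr_unique[OF c(2,3)] enc_child(4) \<open>corr y (rep y) z z'\<close> by auto
    then show ?thesis using enc_child enc_child.IH by simp
  qed
qed

text \<open>
  No edge leads to the type of the whole graph, so an address that starts with a corner of this type
  belongs to the base point.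
\<close>

lemma enc_head: "enc t z w \<Longrightarrow>
  \<exists>t' p u. (t', p) \<in> corners \<and> w = corner_code (t', p) @ u \<and> (t' = base \<longrightarrow> t = base \<and> z = base)"
proof (induction rule: enc.induct)
  case (enc_rim t p)
  then show ?case by (intro exI[of _ t] exI[of _ p] exI[of _ "[]"]) (auto simp: corners_def)
next
  case (enc_child t y z z' w)
  then show ?case using rep_child_not_base by fastforce
qed

text \<open>
  An edge of the graph that starts at the point \<open>p\<close> of a rim leads to the same rim, into a child
  branch, or out of the branch. These are the moves that change the top of the store, push
  one symbol, or pop one. A pop by \<open>s\<close> is the inverse of a push by \<open>bar s\<close>.
\<close>

definition shift_rules :: "'s \<Rightarrow> (bool list \<times> bool list) set" where
  "shift_rules s = {(corner_code (t, p), corner_code (t, p \<cdot> s)) | t p.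
     t \<in> types \<and> p \<in> rim t \<and> p \<cdot> s \<in> rim t}"

definition push_rules :: "'s \<Rightarrow> (bool list \<times> bool list) set" where
  "push_rules s = {(corner_code (t, p), corner_code (rep y, q) @ edge_code (rep y) (t, y)) | t p y q.
     t \<in> types \<and> p \<in> rim t \<and> child t y \<and> corr y (rep y) (p \<cdot> s) q}"

definition rules :: "'s \<Rightarrow> (bool list \<times> bool list) set" where
  "rules s = shift_rules s \<union> push_rules s \<union> (push_rules (bar s))\<inverse>"

lemma rim_in: "p \<in> rim t \<Longrightarrow> t \<in> types \<Longrightarrow> p \<in> X"
  using branch_in types_in by (auto simp: rim_def)

lemma rules_bar: "s \<in> \<Sigma> \<Longrightarrow> rules (bar s) = (rules s)\<inverse>"
proof -
  have *: "shift_rules (bar s) \<subseteq> (shift_rules s)\<inverse>" if "s \<in> \<Sigma>" for s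
    using that rim_in unfolding shift_rules_def by fastforce
  assume s: "s \<in> \<Sigma>"
  have "shift_rules (bar s) = (shift_rules s)\<inverse>" using *[OF s] *[of "bar s"] s by auto
  then show ?thesis using s by (auto simp: rules_def)
qed

lemma push_lev:
  assumes "t \<in> types" "p \<in> rim t" "child t y" "corr y (rep y) (p \<cdot> s) q" "s \<in> \<Sigma>"
  shows "lev (p \<cdot> s) = Suc (lev t)" "q \<in> rim (rep y)" "p \<cdot> s \<in> branch y"
proof -
  note c = child_rep[OF assms(1,3)]
  show b: "p \<cdot> s \<in> branch y" using corr_left assms by blast
  show l: "lev (p \<cdot> s) = Suc (lev t)"
    using branch_lev[OF b] c(5) lev_act_le[OF rim_in[OF assms(2,1)] assms(5)] assms(2) by (simp add: rim_def)
  show "q \<in> rim (rep y)"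
    using corr_right[OF c(2,3) assms(4)] corr_lev[OF c(2,3) assms(4)] l c by (simp add: rim_def)
qed

lemma finite_rules:
  assumes "s \<in> \<Sigma>"
  shows "finite (rules s)"
proof -
  have push: "finite (push_rules s)" if s: "s \<in> \<Sigma>" for s
  proof (rule finite_subset)
    let ?h = "\<lambda>((t, p), y, q). (corner_code (t, p), corner_code (rep y, q) @ edge_code (rep y) (t, y))"
    let ?D = "SIGMA (t, p):corners. SIGMA y:{y. child t y}. rim (rep y)"
    show "push_rules s \<subseteq> ?h ` ?D"
    proof
      fix r assume "r \<in> push_rules s"
      then obtain t p y q where r: "r = ?h ((t, p), y, q)" "t \<in> types" "p \<in> rim t" "child t y"
        "corr y (rep y) (p \<cdot> s) q" by (auto simp: push_rules_def)
      then have "((t, p), y, q) \<in> ?D" using push_lev(2)[OF r(2-5) s] by (auto simp: corners_def)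
      then show "r \<in> ?h ` ?D" using r(1) by (rule rev_image_eqI)
    qed
    show "finite (?h ` ?D)"
      by (intro finite_imageI finite_SigmaI finite_corners)
        (auto simp: corners_def intro!: finite_SigmaI finite_children finite_rim rep_in intro: child_in types_in)
  qed
  have "finite (shift_rules s)"
  proof (rule finite_subset)
    show "shift_rules s \<subseteq> (\<lambda>(t, p). (corner_code (t, p), corner_code (t, p \<cdot> s))) ` corners"
      by (auto simp: shift_rules_def corners_def)
  qed (use finite_corners in simp)
  then show ?thesis using push assms by (simp add: rules_def)
qed

text \<open>
  The first code word of \<open>\<xi>\<close> gives a type \<open>t\<close> and a point \<open>p\<close> on its rim, and the level of \<open>p \<cdot> s\<close> tells
  which kind of rule applies. Only a pop needs the second code word, to know in which
  branch the edge ends.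
\<close>

lemma ex1_rule:
  assumes s: "s \<in> \<Sigma>"
  shows "\<exists>!r. r \<in> rules s \<and> \<xi> \<in> cone (fst r)"
proof -
  obtain a where a: "a \<in> corners" "\<xi> \<in> cone (corner_code a)"
    "\<And>b. b \<in> corners \<Longrightarrow> \<xi> \<in> cone (corner_code b) \<Longrightarrow> b = a"
    using complete_codeE[OF corner_code(1), of \<xi>] by metis
  obtain t p where "a = (t, p)" by (cases a)
  with a have tp: "t \<in> types" "p \<in> rim t" "\<xi> \<in> cone (corner_code (t, p))"
    and tp_unique: "t' \<in> types \<Longrightarrow> p' \<in> rim t' \<Longrightarrow> \<xi> \<in> cone (corner_code (t', p')) \<Longrightarrow> t' = t \<and> p' = p" for t' p'
    by (auto simp: corners_def)
  obtain \<xi>' where \<xi>': "\<xi> = corner_code (t, p) @- \<xi>'" using tp by (auto simp: cone_iff)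
  have X: "t \<in> X" "p \<in> X" "p \<in> branch t" "lev p = lev t"
    using tp types_in rim_in by (auto simp: rim_def)
  have cases: thesis
    if r: "r \<in> rules s" "\<xi> \<in> cone (fst r)"
    and shift: "p \<cdot> s \<in> rim t \<Longrightarrow> r = (corner_code (t, p), corner_code (t, p \<cdot> s)) \<Longrightarrow> thesis"
    and push: "\<And>y q. child t y \<Longrightarrow> corr y (rep y) (p \<cdot> s) q \<Longrightarrow> p \<cdot> s \<in> branch y \<Longrightarrow> lev (p \<cdot> s) = Suc (lev t) \<Longrightarrow>
      r = (corner_code (t, p), corner_code (rep y, q) @ edge_code (rep y) (t, y)) \<Longrightarrow> thesis"
    and pop: "\<And>t1 y p1 z. (t1, y) \<in> edges_to t \<Longrightarrow> \<xi>' \<in> cone (edge_code t (t1, y)) \<Longrightarrow>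
      corr y t z p \<Longrightarrow> p1 = z \<cdot> s \<Longrightarrow> lev (p \<cdot> s) < lev t \<Longrightarrow>
      r = (corner_code (t, p) @ edge_code t (t1, y), corner_code (t1, p1)) \<Longrightarrow> thesis" for r thesis
  proof -
    consider "r \<in> shift_rules s" | "r \<in> push_rules s" | "r \<in> (push_rules (bar s))\<inverse>"
      using r by (auto simp: rules_def)
    then show thesis
    proof cases
      case 1
      then show ?thesis using r tp_unique shift by (auto simp: shift_rules_def)
    next
      case 2
      then obtain t' p' y q where *: "r = (corner_code (t', p'), corner_code (rep y, q) @ edge_code (rep y) (t', y))"
        "t' \<in> types" "p' \<in> rim t'" "child t' y" "corr y (rep y) (p' \<cdot> s) q"
        by (auto simp: push_rules_def)
      then have "t' = t" "p' = p" using tp_unique r by auto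
      then show ?thesis using push[of y q] * push_lev[OF *(2-5) s] by auto
    next
      case 3
      then obtain t1 p1 y q where *: "r = (corner_code (rep y, q) @ edge_code (rep y) (t1, y), corner_code (t1, p1))"
        "t1 \<in> types" "p1 \<in> rim t1" "child t1 y" "corr y (rep y) (p1 \<cdot> bar s) q"
        by (auto simp: push_rules_def)
      note c = child_rep[OF *(2,4)]
      have q: "q \<in> rim (rep y)" using push_lev[OF *(2-5)] s by simp
      have e: "rep y = t \<and> q = p"
        by (rule tp_unique) (use c q r * cone_append_subset in auto)
      have p1: "p1 = p1 \<cdot> bar s \<cdot> s" using rim_in * s by simp
      have "lev p1 = lev t1" using * by (simp add: rim_def)
      then have "\<not> lev y \<le> lev (p1 \<cdot> bar s \<cdot> s)" using c(5) p1 by simp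
      then have "lev (p \<cdot> s) < lev t" using corr_act(1)[OF c(2,3) *(5) s] e by simp
      moreover have "\<xi>' \<in> cone (edge_code t (t1, y))" using r * e \<xi>' by auto
      ultimately show ?thesis using pop[of t1 y "p1 \<cdot> bar s" p1] * e p1 by (auto simp: edges_to_def)
    qed
  qed
  consider (shift) "p \<cdot> s \<in> rim t" | (push) "lev (p \<cdot> s) = Suc (lev t)" | (pop) "lev (p \<cdot> s) < lev t"
    using branch_act[OF X(3) s] lev_act_le[OF X(2) s] X(4) unfolding rim_def
    by (metis (mono_tags, lifting) le_SucE linorder_not_less mem_Collect_eq order.antisym)
  then show ?thesis
  proof cases
    case shift
    then have l: "lev (p \<cdot> s) = lev t" by (simp add: rim_def)
    show ?thesis
    proof (rule ex1I[of _ "(corner_code (t, p), corner_code (t, p \<cdot> s))"])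
      show "(corner_code (t, p), corner_code (t, p \<cdot> s)) \<in> rules s \<and> \<xi> \<in> cone (fst (corner_code (t, p), corner_code (t, p \<cdot> s)))"
        using shift tp by (auto simp: rules_def shift_rules_def)
      fix r assume "r \<in> rules s \<and> \<xi> \<in> cone (fst r)"
      then show "r = (corner_code (t, p), corner_code (t, p \<cdot> s))"
        by (elim conjE, elim cases) (use l in auto)
    qed
  next
    case push
    then have "p \<cdot> s \<in> branch t" using branch_act[OF X(3) s] by simp
    then obtain y where y: "child t y" "p \<cdot> s \<in> branch y" using child_exists[OF X(1), of "p \<cdot> s"] push by auto
    note c = child_rep[OF tp(1) y(1)]
    obtain q where q: "corr y (rep y) (p \<cdot> s) q" using corr_total y by blast
    show ?thesis
    proof (rule ex1I[of _ "(corner_code (t, p), corner_code (rep y, q) @ edge_code (rep y) (t, y))"])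
      show "(corner_code (t, p), corner_code (rep y, q) @ edge_code (rep y) (t, y)) \<in> rules s \<and>
        \<xi> \<in> cone (fst (corner_code (t, p), corner_code (rep y, q) @ edge_code (rep y) (t, y)))"
        using tp y q by (auto simp: rules_def push_rules_def)
      fix r assume r: "r \<in> rules s \<and> \<xi> \<in> cone (fst r)"
      show "r = (corner_code (t, p), corner_code (rep y, q) @ edge_code (rep y) (t, y))"
      proof (rule cases)
        fix y' q' assume a: "child t y'" "corr y' (rep y') (p \<cdot> s) q'" "p \<cdot> s \<in> branch y'"
          "r = (corner_code (t, p), corner_code (rep y', q') @ edge_code (rep y') (t, y'))"
        have y': "y' = y" using child_unique[OF X(1) a(1) y(1) a(3) y(2)] .
        then have "q' = q" using corr_unique[OF c(2,3) q] a(2) by auto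
        then show ?thesis using y' a by simp
      qed (use r push in \<open>auto simp: rim_def\<close>)
    qed
  next
    case pop
    then have "t \<noteq> base" by auto
    note ec = edge_code[OF tp(1) this]
    obtain t1 y where e: "(t1, y) \<in> edges_to t" "\<xi>' \<in> cone (edge_code t (t1, y))"
      and e_unique: "\<And>e. e \<in> edges_to t \<Longrightarrow> \<xi>' \<in> cone (edge_code t e) \<Longrightarrow> e = (t1, y)"
      using complete_codeE[OF ec(1), of \<xi>'] by (metis surj_pair)
    then have e': "t1 \<in> types" "child t1 y" "rep y = t" by (auto simp: edges_to_def)
    note c = child_rep[OF e'(1,2)]
    obtain z where z: "corr y t z p" using corr_surj[OF c(2,3)] X(3) e'(3) by auto
    have zX: "z \<in> X" using corr_left[OF z] branch_in c by blast
    have zl: "lev z = lev y" using corr_lev[OF c(2,3)] z e'(3) X(4) by fastforce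
    have "\<not> lev y \<le> lev (z \<cdot> s)" using corr_act(1)[OF c(2,3) _ s, of z p] z e'(3) pop by simp
    then have l: "lev (z \<cdot> s) = lev t1" using lev_le_act[OF zX s] zl c(5) by simp
    have "z \<cdot> s \<in> branch t1"
      by (rule branch_act[OF child_branch[OF e'(2) corr_left[OF z]] s]) (simp add: l)
    then have rim: "z \<cdot> s \<in> rim t1" using l by (simp add: rim_def)
    let ?r = "(corner_code (t, p) @ edge_code t (t1, y), corner_code (t1, z \<cdot> s))"
    show ?thesis
    proof (rule ex1I[of _ ?r])
      have "(corner_code (t1, z \<cdot> s), corner_code (rep y, p) @ edge_code (rep y) (t1, y)) \<in> push_rules (bar s)"
        unfolding push_rules_def using e' rim z zX s
        by (intro CollectI exI[of _ t1] exI[of _ "z \<cdot> s"] exI[of _ y] exI[of _ p]) auto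
      then show "?r \<in> rules s \<and> \<xi> \<in> cone (fst ?r)"
        using e' e \<xi>' by (auto simp: rules_def)
      fix r assume r: "r \<in> rules s \<and> \<xi> \<in> cone (fst r)"
      show "r = ?r"
      proof (rule cases)
        fix t1' y' p1 z' assume a: "(t1', y') \<in> edges_to t" "\<xi>' \<in> cone (edge_code t (t1', y'))"
          "corr y' t z' p" "p1 = z' \<cdot> s" "r = (corner_code (t, p) @ edge_code t (t1', y'), corner_code (t1', p1))"
        have y': "t1' = t1" "y' = y" using e_unique[OF a(1,2)] by auto
        then have "z' = z" using corr_unique[OF c(2,3)] z a(3) e'(3) by auto
        then show ?thesis using y' a by simp
      qed (use r pop in \<open>auto simp: rim_def\<close>)
    qed
  qed
qed

lemma letter_rules:
  assumes s: "s \<in> \<Sigma>"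
  obtains g where "g \<in> carrier Thompson_V" "\<And>\<alpha> \<beta> \<eta>. (\<alpha>, \<beta>) \<in> rules s \<Longrightarrow> g (\<alpha> @- \<eta>) = \<beta> @- \<eta>"
proof (rule Thompson_V_of_rules[OF finite_rules[OF s] ex1_rule[OF s]])
  fix \<xi>
  have "\<exists>!r. r \<in> (rules s)\<inverse> \<and> \<xi> \<in> cone (fst r)" using ex1_rule[of "bar s" \<xi>] rules_bar s by simp
  then obtain a b where ab: "(a, b) \<in> (rules s)\<inverse>" "\<xi> \<in> cone a"
    "\<And>r. r \<in> (rules s)\<inverse> \<Longrightarrow> \<xi> \<in> cone (fst r) \<Longrightarrow> r = (a, b)" by (metis prod.collapse)
  show "\<exists>!r. r \<in> rules s \<and> \<xi> \<in> cone (snd r)"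
  proof (rule ex1I[of _ "(b, a)"])
    show "(b, a) \<in> rules s \<and> \<xi> \<in> cone (snd (b, a))" using ab(1,2) by simp
    fix r assume "r \<in> rules s \<and> \<xi> \<in> cone (snd r)"
    then show "r = (b, a)" using ab(3)[of "(snd r, fst r)"] by (cases r) simp
  qed
qed (use that in blast)

text \<open>
  Descending into child branches does not change the step, as isomorphisms of branches commute with
  letters; only the description of the innermost branch that contains the edge is rewritten.
\<close>

lemma enc_act:
  assumes s: "s \<in> \<Sigma>" and g: "\<And>\<alpha> \<beta> \<eta>. (\<alpha>, \<beta>) \<in> rules s \<Longrightarrow> g (\<alpha> @- \<eta>) = \<beta> @- \<eta>"
    and "enc t z w" "z \<cdot> s \<in> branch t"
  shows "\<exists>w'. enc t (z \<cdot> s) w' \<and> (\<forall>\<eta>. g (w @- \<eta>) = w' @- \<eta>)"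
  using assms(3,4)
proof (induction rule: enc.induct)
  case (enc_rim t p)
  have X: "t \<in> X" "p \<in> X" "lev p = lev t" using enc_rim types_in rim_in by (auto simp: rim_def)
  show ?case
  proof (cases "lev (p \<cdot> s) = lev t")
    case True
    then have "p \<cdot> s \<in> rim t" using enc_rim by (simp add: rim_def)
    then have "(corner_code (t, p), corner_code (t, p \<cdot> s)) \<in> rules s" "enc t (p \<cdot> s) (corner_code (t, p \<cdot> s))"
      using enc_rim enc.enc_rim by (auto simp: rules_def shift_rules_def)
    then show ?thesis using g by blast
  next
    case False
    then have "lev t < lev (p \<cdot> s)" using branch_lev enc_rim(3) le_neq_implies_less by metis
    then obtain y where y: "child t y" "p \<cdot> s \<in> branch y" using child_exists X(1) enc_rim(3) by metis
    obtain q where q: "corr y (rep y) (p \<cdot> s) q" using corr_total y by blast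
    have "q \<in> rim (rep y)" using push_lev[OF enc_rim(1,2) y(1) q s] by simp
    then have "enc (rep y) q (corner_code (rep y, q))" using rep_types enc_rim y enc.enc_rim by blast
    then have "enc t (p \<cdot> s) (corner_code (rep y, q) @ edge_code (rep y) (t, y))"
      using enc_child[OF enc_rim(1) y(1) q] by blast
    moreover have "(corner_code (t, p), corner_code (rep y, q) @ edge_code (rep y) (t, y)) \<in> rules s"
      using enc_rim y q by (auto simp: rules_def push_rules_def)
    ultimately show ?thesis using g by blast
  qed
next
  case (enc_child t y z z' w)
  note c = child_rep[OF enc_child(1,2)]
  note z = corr_left[OF enc_child(3)]
  have zX: "z \<in> X" using branch_in z c by blast
  show ?case
  proof (cases "lev y \<le> lev (z \<cdot> s)")
    case True
    note step = corr_act[OF c(2,3) enc_child(3) s]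
    have "corr y (rep y) (z \<cdot> s) (z' \<cdot> s)" using step(2) True .
    moreover then have "z' \<cdot> s \<in> branch (rep y)" using corr_right[OF c(2,3)] by blast
    then obtain w' where "enc (rep y) (z' \<cdot> s) w'" "\<forall>\<eta>. g (w @- \<eta>) = w' @- \<eta>"
      using enc_child.IH by blast
    ultimately show ?thesis using enc.enc_child[OF enc_child(1,2)] by (metis shift_append)
  next
    case False
    then have l: "lev (z \<cdot> s) = lev t" "lev z = lev y"
      using c(5) branch_lev[OF enc_child(6)] branch_lev[OF z] lev_le_act[OF zX s] by auto
    then have rim: "z \<cdot> s \<in> rim t" using enc_child by (simp add: rim_def)
    have "lev z' = lev (rep y)" using corr_lev[OF c(2,3) enc_child(3)] l by simp
    then have w: "w = corner_code (rep y, z')" using enc_rim_eq enc_child by blast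
    have "(corner_code (t, z \<cdot> s), corner_code (rep y, z') @ edge_code (rep y) (t, y)) \<in> push_rules (bar s)"
      unfolding push_rules_def using rim enc_child(1-3) s zX
      by (intro CollectI exI[of _ t] exI[of _ "z \<cdot> s"] exI[of _ y] exI[of _ z']) auto
    then have "(w @ edge_code (rep y) (t, y), corner_code (t, z \<cdot> s)) \<in> rules s"
      unfolding w by (simp add: rules_def)
    then show ?thesis using g enc.enc_rim[OF enc_child(1) rim] by blast
  qed
qed

text \<open>
  The words that continue the description of a point in the representative \<open>t\<close> to an address in the whole graph.
\<close>

inductive tail :: "'x \<Rightarrow> bool list \<Rightarrow> bool" where
  tail_base: "tail base []"
| tail_edge: "t \<in> types \<Longrightarrow> child t y \<Longrightarrow> tail t w \<Longrightarrow> tail (rep y) (edge_code (rep y) (t, y) @ w)"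

lemma tail_enc: "tail t w \<Longrightarrow> enc t z u \<Longrightarrow> \<exists>x\<in>X. enc base x (u @ w)"
proof (induction arbitrary: z u rule: tail.induct)
  case tail_base
  then show ?case using enc_branch[OF tail_base] branch_base by auto
next
  case (tail_edge t y w)
  note c = child_rep[OF tail_edge(1,2)]
  obtain z0 where "corr y (rep y) z0 z" using corr_surj[OF c(2,3)] enc_branch[OF tail_edge(5)] by blast
  then show ?case using tail_edge.IH[OF enc_child[OF tail_edge(1,2) _ tail_edge(5)]] by simp
qed

lemma tail_exists: "t \<in> types \<Longrightarrow> \<exists>w. tail t w"
  by (induction rule: types.induct) (auto intro: tail.intros)

text \<open>
  Match \<open>v\<close> with the codes of edges, one after the other. The word to be matched gets shorter unless a
  code word is empty. In that case there is only one edge into the type, and the induction on how the type is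
  reached from the whole graph goes through this very edge.
\<close>

lemma tail_dense: "t \<in> types \<Longrightarrow> \<exists>w \<eta>. tail t w \<and> w @- \<eta> \<in> cone v"
proof (induction "length v" arbitrary: t v rule: less_induct)
  case less
  from less(2) show ?case
  proof (induction rule: types.induct)
    case base_types
    then show ?case using tail_base shift_in_cone[of v] by (metis shift.simps(1))
  next
    case (rep_types t0 y0)
    let ?t = "rep y0"
    have t: "?t \<in> types" "?t \<noteq> base" using types.rep_types rep_child_not_base rep_types by auto
    note ec = edge_code[OF t]
    obtain t1 y1 where e: "(t1, y1) \<in> edges_to ?t" "v @- sconst False \<in> cone (edge_code ?t (t1, y1))"
      using complete_codeE[OF ec(1)] by (metis surj_pair)
    then have e': "t1 \<in> types" "child t1 y1" "rep y1 = ?t" by (auto simp: edges_to_def)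
    from e(2) show ?case
    proof (cases rule: cone_comparable)
      case (1 r)
      obtain w where "tail t1 w" using tail_exists e' by blast
      then have "tail ?t (edge_code ?t (t1, y1) @ w)" using tail_edge e' by metis
      then show ?thesis using 1 by (metis shift_append shift_in_cone append_assoc)
    next
      case (2 r)
      show ?thesis
      proof (cases "edge_code ?t (t1, y1) = []")
        case True
        then have "edges_to ?t = {(t1, y1)}" using ec(2) e by blast
        moreover have "(t0, y0) \<in> edges_to ?t" using rep_types by (simp add: edges_to_def)
        ultimately have [simp]: "t1 = t0" "y1 = y0" by auto
        obtain w \<eta> where "tail t0 w" "w @- \<eta> \<in> cone v" using rep_types by blast
        then show ?thesis using tail_edge[OF rep_types(1,2)] True by (metis append_Nil \<open>t1 = t0\<close> \<open>y1 = y0\<close>)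
      next
        case False
        then have "length r < length v" using 2 by simp
        then obtain w \<eta> where w: "tail t1 w" "w @- \<eta> \<in> cone r" using less(1) e' by blast
        have "tail ?t (edge_code ?t (t1, y1) @ w)" using tail_edge w e' by metis
        moreover have "(edge_code ?t (t1, y1) @ w) @- \<eta> \<in> cone v" using w 2 by simp
        ultimately show ?thesis by blast
      qed
    qed
  qed
qed

lemma enc_dense: "\<exists>x\<in>X. \<exists>w \<eta>. enc base x w \<and> w @- \<eta> \<in> cone v"
proof -
  obtain t p where tp: "(t, p) \<in> corners" "v @- sconst False \<in> cone (corner_code (t, p))"
    using complete_codeE[OF corner_code(1)] by (metis surj_pair)
  then have t: "t \<in> types" "enc t p (corner_code (t, p))" by (auto simp: corners_def intro: enc_rim)
  from tp(2) show ?thesis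
  proof (cases rule: cone_comparable)
    case (1 r)
    obtain w where "tail t w" using tail_exists t by blast
    then obtain x where "x \<in> X" "enc base x (corner_code (t, p) @ w)" using tail_enc t by blast
    then show ?thesis using 1 by (metis shift_append shift_in_cone append_assoc)
  next
    case (2 r)
    obtain w \<eta> where w: "tail t w" "w @- \<eta> \<in> cone r" using tail_dense t by blast
    then obtain x where "x \<in> X" "enc base x (corner_code (t, p) @ w)" using tail_enc t by blast
    moreover have "(corner_code (t, p) @ w) @- \<eta> \<in> cone v" using w 2 by simp
    ultimately show ?thesis by blast
  qed
qed

definition address :: "'x \<Rightarrow> bool list" where
  "address x = (THE w. enc base x w)"

lemma address_eq: "enc base x w \<Longrightarrow> address x = w"
  unfolding address_def using enc_unique by blast

lemma enc_address: "x \<in> X \<Longrightarrow> enc base x (address x)"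
  using enc_total[of base x] address_eq by auto

lemma address_act:
  assumes "s \<in> \<Sigma>"
  obtains g where "g \<in> carrier Thompson_V" "\<And>x \<eta>. x \<in> X \<Longrightarrow> g (address x @- \<eta>) = address (x \<cdot> s) @- \<eta>"
proof -
  obtain g where g: "g \<in> carrier Thompson_V" "\<And>\<alpha> \<beta> \<eta>. (\<alpha>, \<beta>) \<in> rules s \<Longrightarrow> g (\<alpha> @- \<eta>) = \<beta> @- \<eta>"
    using letter_rules[OF assms] by blast
  have "g (address x @- \<eta>) = address (x \<cdot> s) @- \<eta>" if "x \<in> X" for x \<eta>
    using enc_act[OF assms g(2) enc_address[OF that]] that assms address_eq by auto
  then show ?thesis using that g(1) by blast
qed

lemma address_dense: "\<exists>x\<in>X. \<exists>\<eta>. address x @- \<eta> \<in> cone v"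
  using enc_dense address_eq by metis

lemma address_base: "address base = corner_code (base, base)"
  by (rule address_eq) (simp add: enc_rim)

lemma address_base_zeros: "address base \<in> lists {False}"
  using address_base corner_code by simp

lemma address_in_cone_base:
  assumes "x \<in> X" "address x @- \<eta> \<in> cone (address base)"
  shows "x = base"
proof -
  obtain t p u where *: "(t, p) \<in> corners" "address x = corner_code (t, p) @ u" "t = base \<longrightarrow> x = base"
    using enc_head[OF enc_address[OF assms(1)]] by blast
  have "address x @- \<eta> \<in> cone (corner_code (t, p))" using * by simp
  moreover have "(base, base) \<in> corners" by (simp add: corners_def)
  ultimately have "(t, p) = (base, base)"
    using complete_codeE[OF corner_code(1), of "address x @- \<eta>"] * assms(2) address_base by metis
  then show ?thesis using * by simp
qed

end


context context_free_schreier_graph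
begin

lemma tree_like: "\<exists>rep. tree_like_graph X \<Sigma> act bar base rep"
proof -
  define r where "r \<tau> = (SOME y. y \<in> X \<and> branch_type y = \<tau>)" for \<tau>
  have r: "r (branch_type x) \<in> X \<and> branch_type (r (branch_type x)) = branch_type x" if "x \<in> X" for x
    unfolding r_def by (rule someI[of _ x]) (use that in simp)
  have "tree_like_graph X \<Sigma> act bar base (\<lambda>x. r (branch_type x))"
  proof unfold_locales
    show "finite ((\<lambda>x. r (branch_type x)) ` X)"
      using finite_imageI[OF finite_branch_types, of r X] by (simp add: image_image)
    show "branch_iso x (r (branch_type x))" if "x \<in> X" for x
      using branch_iso_if_same_type[of x "r (branch_type x)"] r[OF that] that by simp
  qed (use r in blast)
  then show ?thesis by blast
qed

end

section \<open>From context-free subgroups to homomorphisms into V\<close>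

lemma symmetric_homD:
  assumes "symmetric_hom \<Sigma> bar G \<rho>"
  shows "u \<in> lists \<Sigma> \<Longrightarrow> \<rho> u \<in> carrier G"
    "u \<in> lists \<Sigma> \<Longrightarrow> v \<in> lists \<Sigma> \<Longrightarrow> \<rho> (u @ v) = \<rho> u \<otimes>\<^bsub>G\<^esub> \<rho> v"
    "\<rho> [] = \<one>\<^bsub>G\<^esub>" "u \<in> lists \<Sigma> \<Longrightarrow> \<rho> (word_bar bar u) = inv\<^bsub>G\<^esub> \<rho> u"
  using assms by (auto simp: symmetric_hom_def hom_def word_monoid_def)

text \<open>
  An element \<open>g\<close> is sent to the unique element of V that maps \<open>address x @- \<eta>\<close> to \<open>address (x #> g) @- \<eta>\<close>
  for all cosets \<open>x\<close> and all \<open>\<eta>\<close>. Existence is clear for letters and passes to products, and uniqueness comes from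
  density. Uniqueness also makes the map a homomorphism, whatever the relations of the group are.
\<close>

theorem hom_to_Thompson_V_if_context_free:
  fixes G :: "('a, 'b) monoid_scheme" (structure) and H :: "'a set"
  assumes "group G" "subgroup H G" "context_free_subgroup H G"
  shows "\<exists>\<phi> \<in> hom G Thompson_V. {g \<in> carrier G. \<phi> g \<in> Thompson_V_stab} = H"
proof -
  interpret group G by fact
  obtain \<Sigma> :: "nat set" and bar \<rho> where \<Sigma>: "symmetric_alphabet \<Sigma> bar" and hom: "symmetric_hom \<Sigma> bar G \<rho>"
    and onto: "\<rho> ` lists \<Sigma> = carrier G" and "context_free (membership_problem \<Sigma> \<rho> H)"
    using assms(3) by (auto simp: context_free_subgroup_def)
  then obtain P :: "(nat, nat) production set" and S
    where P: "finite P" "membership_problem \<Sigma> \<rho> H = grammar_language P S"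
    by (auto simp: context_free_def)
  note \<rho> = symmetric_homD[OF hom]
  have HG: "H \<subseteq> carrier G" using assms(2) by (rule subgroup.subset)
  define act where "act x s = x #> \<rho> [s]" for x and s :: nat
  have walk: "foldl act (H #> g) w = H #> (g \<otimes> \<rho> w)" if "g \<in> carrier G" "w \<in> lists \<Sigma>" for g w
    using that
  proof (induction w arbitrary: g)
    case (Cons s w)
    then have c: "\<rho> [s] \<in> carrier G" "\<rho> w \<in> carrier G" "\<rho> (s # w) = \<rho> [s] \<otimes> \<rho> w"
      using \<rho>(1)[of "[s]"] \<rho>(1)[of w] \<rho>(2)[of "[s]" w] by auto
    have "foldl act (H #> g) (s # w) = foldl act (H #> (g \<otimes> \<rho> [s])) w"
      using Cons.prems c coset_mult_assoc[OF HG] by (simp add: act_def)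
    then show ?case using Cons c by (simp add: m_assoc)
  qed (use \<rho>(3) in simp)
  have walk_H: "foldl act H w = H #> \<rho> w" if "w \<in> lists \<Sigma>" for w
    using walk[of \<one> w] that \<rho>(1)[OF that] HG by simp
  have fix_iff: "H #> g = H \<longleftrightarrow> g \<in> H" if "g \<in> carrier G" for g
    using coset_join1[of H g] coset_join2[of g H] that assms(2) by blast
  interpret context_free_schreier_graph "rcosets H" \<Sigma> act bar H P S
  proof unfold_locales
    show "finite \<Sigma>" using \<Sigma> by (simp add: symmetric_alphabet_def)
    fix s assume s: "s \<in> \<Sigma>"
    show "bar s \<in> \<Sigma>" "bar (bar s) = s" using \<Sigma> s by (auto simp: symmetric_alphabet_def)
    fix x assume "x \<in> rcosets H"
    then obtain g where g: "g \<in> carrier G" "x = H #> g" by (auto simp: RCOSETS_def)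
    have 1: "\<rho> [s] \<in> carrier G" "\<rho> [bar s] = inv \<rho> [s]"
      using \<rho>(1)[of "[s]"] \<rho>(4)[of "[s]"] s by (auto simp: word_bar_def)
    show "act x s \<in> rcosets H"
      using g 1 by (simp add: act_def coset_mult_assoc[OF HG] rcosetsI[OF HG])
    show "act (act x s) (bar s) = x"
      using g 1 by (simp add: act_def coset_mult_assoc[OF HG] m_assoc)
  next
    show "H \<in> rcosets H" using rcosetsI[OF HG, of \<one>] HG by simp
    fix x assume "x \<in> rcosets H"
    then obtain g where g: "g \<in> carrier G" "x = H #> g" by (auto simp: RCOSETS_def)
    then obtain w where w: "w \<in> lists \<Sigma>" "\<rho> w = g" using onto by (metis imageE)
    then show "\<exists>w\<in>lists \<Sigma>. foldl act H w = x" using walk_H g by (intro bexI[of _ w]) simp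
  next
    show "finite P" by (rule P)
    have "{w. yields P [Nt S] w} = membership_problem \<Sigma> \<rho> H"
      using P(2) by (simp add: grammar_language_yields)
    also have "\<dots> = {w \<in> lists \<Sigma>. foldl act H w = H}"
    proof -
      have "\<rho> w \<in> H \<longleftrightarrow> foldl act H w = H" if "w \<in> lists \<Sigma>" for w
        using walk_H[OF that] fix_iff[OF \<rho>(1)[OF that]] by simp
      then show ?thesis unfolding membership_problem_def by blast
    qed
    finally show "{w. yields P [Nt S] w} = {w \<in> lists \<Sigma>. foldl act H w = H}" .
  qed
  obtain rep where "tree_like_graph (rcosets H) \<Sigma> act bar H rep" using tree_like by blast
  then interpret tree_like_graph "rcosets H" \<Sigma> act bar H rep .
  define lifts where "lifts g h \<longleftrightarrow> h \<in> carrier Thompson_V \<and>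
    (\<forall>x\<in>rcosets H. \<forall>\<eta>. h (address x @- \<eta>) = address (x #> g) @- \<eta>)" for g h
  have coset: "x \<subseteq> carrier G" "x #> g \<in> rcosets H" if x: "x \<in> rcosets H" and g: "g \<in> carrier G" for x g
  proof -
    obtain k where k: "k \<in> carrier G" "x = H #> k" using x by (auto simp: RCOSETS_def)
    show "x \<subseteq> carrier G" using r_coset_subset_G[OF HG k(1)] k(2) by simp
    show "x #> g \<in> rcosets H" using k g coset_mult_assoc[OF HG k(1)] rcosetsI[OF HG] by simp
  qed
  have lifts_mult: "lifts (g \<otimes> g') (h' \<circ> h)"
    if "lifts g h" "lifts g' h'" "g \<in> carrier G" "g' \<in> carrier G" for g g' h h'
    using that comp_Thompson_V[of h h'] coset(2) coset_mult_assoc[OF coset(1)[OF _ that(3)]]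
    by (auto simp: lifts_def)
  have lifts_unique: "h = h'" if "lifts g h" "lifts g h'" for g h h'
  proof (rule Thompson_V_eq_if_dense)
    fix v
    obtain x \<eta> where "x \<in> rcosets H" "address x @- \<eta> \<in> cone v" using address_dense by blast
    then show "\<exists>\<xi>\<in>cone v. h \<xi> = h' \<xi>" using that by (intro bexI[of _ "address x @- \<eta>"]) (simp_all add: lifts_def)
  qed (use that in \<open>auto simp: lifts_def\<close>)
  have lifts_word: "\<exists>h. lifts (\<rho> w) h" if "w \<in> lists \<Sigma>" for w
    using that
  proof (induction w)
    case Nil
    have "lifts (\<rho> []) id"
      using id_Thompson_V coset(1)[OF _ one_closed] by (auto simp: lifts_def \<rho>(3) coset_mult_one)
    then show ?case by blast
  next
    case (Cons s w)
    then obtain h where h: "lifts (\<rho> w) h" by auto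
    have s: "s \<in> \<Sigma>" and l: "[s] \<in> lists \<Sigma>" "w \<in> lists \<Sigma>" using Cons by auto
    obtain k where "lifts (\<rho> [s]) k" using address_act[OF s] unfolding lifts_def act_def by metis
    then have "lifts (\<rho> [s] \<otimes> \<rho> w) (h \<circ> k)"
      using lifts_mult[OF _ h \<rho>(1)[OF l(1)] \<rho>(1)[OF l(2)]] by blast
    then show ?case using \<rho>(2)[OF l] by auto
  qed
  define \<phi> where "\<phi> g = (THE h. lifts g h)" for g
  have \<phi>_eq: "\<phi> g = h" if "lifts g h" for g h
    unfolding \<phi>_def using that lifts_unique by blast
  have \<phi>: "lifts g (\<phi> g)" if "g \<in> carrier G" for g
  proof -
    obtain w where "w \<in> lists \<Sigma>" "\<rho> w = g" using onto \<open>g \<in> carrier G\<close> by (metis imageE)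
    then show ?thesis using lifts_word \<phi>_eq by metis
  qed
  have "\<phi> \<in> hom G Thompson_V"
  proof (rule homI)
    show "\<phi> g \<in> carrier Thompson_V" if "g \<in> carrier G" for g using \<phi>[OF that] by (simp add: lifts_def)
    show "\<phi> (g \<otimes> h) = \<phi> g \<otimes>\<^bsub>Thompson_V\<^esub> \<phi> h" if "g \<in> carrier G" "h \<in> carrier G" for g h
      using \<phi>_eq[OF lifts_mult[OF \<phi>[OF that(1)] \<phi>[OF that(2)] that]] by (simp add: Thompson_V_def)
  qed
  moreover have "\<phi> g \<in> Thompson_V_stab \<longleftrightarrow> g \<in> H" if "g \<in> carrier G" for g
  proof -
    obtain n where "address H = replicate n False"
      using address_base_zeros by (metis in_lists_conv_set replicate_eqI singletonD)
    then have z: "sconst False = address H @- sconst False" by simp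
    have l: "\<phi> g \<in> carrier Thompson_V" "\<phi> g (address H @- sconst False) = address (H #> g) @- sconst False"
      using \<phi>[OF that] base_in by (auto simp: lifts_def)
    have "\<phi> g \<in> Thompson_V_stab \<longleftrightarrow> address (H #> g) @- sconst False = address H @- sconst False"
      using l z by (simp add: Thompson_V_stab_def)
    also have "\<dots> \<longleftrightarrow> H #> g = H"
      using address_in_cone_base[of "H #> g" "sconst False"] coset(2)[OF base_in that] shift_in_cone by metis
    finally show ?thesis using fix_iff[OF that] by simp
  qed
  ultimately show ?thesis using HG by blast
qed

section \<open>A grammar for point stabilisers in V\<close>

primrec concat_lang :: "('n \<Rightarrow> 't list set) \<Rightarrow> ('n, 't) symbol list \<Rightarrow> 't list set" where
  "concat_lang I [] = {[]}"
| "concat_lang I (x # \<gamma>) =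
     {u @ v | u v. u \<in> (case x of Nt X \<Rightarrow> I X | Tm a \<Rightarrow> {[a]}) \<and> v \<in> concat_lang I \<gamma>}"

lemma yields_sound:
  assumes "\<And>X \<delta>. (X, \<delta>) \<in> P \<Longrightarrow> concat_lang I \<delta> \<subseteq> I X" and "yields P \<gamma> w"
  shows "w \<in> concat_lang I \<gamma>"
  using assms(2)
proof (induction rule: yields.induct)
  case (yields_Nt X \<delta> u \<gamma> v)
  then show ?case using assms(1) by fastforce
qed auto

lemma yields_production: "(X, \<delta>) \<in> P \<Longrightarrow> yields P \<delta> w \<Longrightarrow> yields P [Nt X] w"
  using yields_Nt[of X \<delta> P w "[]" "[]"] by simp

lemma yields_pair: "yields P [s] u \<Longrightarrow> yields P [t] v \<Longrightarrow> yields P [s, t] (u @ v)"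
  using yields_append[of P "[s]" u "[t]" v] by simp

lemma shift_sconst_eq: "\<alpha> @- sconst x = sconst x \<longleftrightarrow> \<alpha> = replicate (length \<alpha>) x"
proof
  assume "\<alpha> @- sconst x = sconst x"
  then have "set \<alpha> \<subseteq> {x}" using sset_shift[of \<alpha> "sconst x"] by auto
  then show "\<alpha> = replicate (length \<alpha>) x" by (auto intro: replicate_eqI)
next
  assume "\<alpha> = replicate (length \<alpha>) x"
  then show "\<alpha> @- sconst x = sconst x" by (metis shift_replicate_sconst)
qed

text \<open>
  A pushdown store over binary digits: letter \<open>s\<close> removes \<open>N\<close> digits \<open>\<alpha>\<close> from the top and puts back the
  at most \<open>K\<close> digits \<open>f s \<alpha>\<close>.
\<close>

locale prefix_machine =
  fixes \<Sigma> :: "'s set" and h :: "'s \<Rightarrow> bool stream \<Rightarrow> bool stream"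
    and f :: "'s \<Rightarrow> bool list \<Rightarrow> bool list" and N K :: nat
  assumes finite_letters: "finite \<Sigma>"
    and h: "s \<in> \<Sigma> \<Longrightarrow> length \<alpha> = N \<Longrightarrow> h s (\<alpha> @- \<eta>) = f s \<alpha> @- \<eta>"
    and N_le_K: "N \<le> K"
    and length_f: "s \<in> \<Sigma> \<Longrightarrow> length \<alpha> = N \<Longrightarrow> length (f s \<alpha>) \<le> K"
begin

text \<open>
  The store after reading a word, if the digits of \<open>\<alpha>\<close> suffice for all of its steps.
\<close>

fun run :: "'s list \<Rightarrow> bool list \<Rightarrow> bool list option" where
  "run [] \<alpha> = Some \<alpha>"
| "run (s # w) \<alpha> = (if N \<le> length \<alpha> then run w (f s (take N \<alpha>) @ drop N \<alpha>) else None)"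

lemma run_append: "run (u @ v) \<alpha> = Option.bind (run u \<alpha>) (run v)"
  by (induction u arbitrary: \<alpha>) auto

lemma run_extend: "run w \<alpha> = Some \<beta> \<Longrightarrow> run w (\<alpha> @ \<gamma>) = Some (\<beta> @ \<gamma>)"
  by (induction w arbitrary: \<alpha>) (auto split: if_splits simp flip: append_assoc)

lemma run_sound:
  "run w \<alpha> = Some \<beta> \<Longrightarrow> w \<in> lists \<Sigma> \<Longrightarrow> fold h w (\<alpha> @- \<eta>) = \<beta> @- \<eta>"
proof (induction w arbitrary: \<alpha>)
  case (Cons s w)
  then have N: "N \<le> length \<alpha>" "run w (f s (take N \<alpha>) @ drop N \<alpha>) = Some \<beta>" "s \<in> \<Sigma>" "w \<in> lists \<Sigma>"
    by (auto split: if_splits)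
  have "h s (\<alpha> @- \<eta>) = (f s (take N \<alpha>) @ drop N \<alpha>) @- \<eta>"
    using h[OF N(3), of "take N \<alpha>" "drop N \<alpha> @- \<eta>"] N(1) by (simp flip: shift_append)
  then show ?case using Cons.IH[OF N(2,4)] by simp
qed simp

lemma run_first_exit:
  obtains \<beta> where "run w \<alpha> = Some \<beta>"
  | w1 w2 \<gamma> where "w = w1 @ w2" "w2 \<noteq> []" "run w1 \<alpha> = Some \<gamma>" "length \<gamma> < N"
proof (induction w arbitrary: \<alpha> thesis)
  case (Cons s w)
  show ?case
  proof (cases "N \<le> length \<alpha>")
    case True
    show ?thesis
    proof (rule Cons.IH)
      fix \<beta> assume "run w (f s (take N \<alpha>) @ drop N \<alpha>) = Some \<beta>"
      then show thesis using Cons.prems(1) True by simp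
    next
      fix w1 w2 \<gamma> assume "w = w1 @ w2" "w2 \<noteq> []" "run w1 (f s (take N \<alpha>) @ drop N \<alpha>) = Some \<gamma>" "length \<gamma> < N"
      then show thesis using Cons.prems(2)[of "s # w1" w2 \<gamma>] True by simp
    qed
  next
    case False
    then show ?thesis using Cons.prems(2)[of "[]" "s # w" \<alpha>] by simp
  qed
qed simp

text \<open>
  The nonterminals: \<open>W \<alpha> \<beta>\<close> generates words that replace the prefix \<open>\<alpha>\<close> by \<open>\<beta>\<close>, and \<open>Z \<alpha>\<close> the words that
  map \<open>\<alpha>000\<dots>\<close> to \<open>000\<dots>\<close>. Numbers encode them because \<open>context_free\<close> takes nonterminals from \<open>nat\<close>.
\<close>

definition W :: "bool list \<Rightarrow> bool list \<Rightarrow> nat" where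
  "W \<alpha> \<beta> = to_nat (Inl (\<alpha>, \<beta>) :: (bool list \<times> bool list) + bool list)"

definition Z :: "bool list \<Rightarrow> nat" where
  "Z \<alpha> = to_nat (Inr \<alpha> :: (bool list \<times> bool list) + bool list)"

definition meaning :: "nat \<Rightarrow> 's list set" where
  "meaning n = (case from_nat n of
     Inl (\<alpha>, \<beta>) \<Rightarrow> {w \<in> lists \<Sigma>. \<forall>\<eta>. fold h w (\<alpha> @- \<eta>) = \<beta> @- \<eta>}
   | Inr \<alpha> \<Rightarrow> {w \<in> lists \<Sigma>. fold h w (\<alpha> @- sconst False) = sconst False})"

lemma meaning_W: "meaning (W \<alpha> \<beta>) = {w \<in> lists \<Sigma>. \<forall>\<eta>. fold h w (\<alpha> @- \<eta>) = \<beta> @- \<eta>}"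
  and meaning_Z: "meaning (Z \<alpha>) = {w \<in> lists \<Sigma>. fold h w (\<alpha> @- sconst False) = sconst False}"
  by (simp_all add: meaning_def W_def Z_def)

definition contents :: "bool list set" where
  "contents = {\<alpha>. length \<alpha> \<le> K}"

text \<open>
  The bounds on the contents make the set finite. That contents of bounded length suffice is the point of
  \<open>W_complete\<close> and \<open>Z_complete\<close>.
\<close>

inductive_set productions :: "(nat, 's) production set" where
  W_Nil: "\<alpha> \<in> contents \<Longrightarrow> (W \<alpha> \<alpha>, []) \<in> productions"
| W_step: "s \<in> \<Sigma> \<Longrightarrow> \<alpha> \<in> contents \<Longrightarrow> length \<alpha> = N \<Longrightarrow> \<beta> \<in> contents \<Longrightarrow>
    (W \<alpha> \<beta>, [Tm s, Nt (W (f s \<alpha>) \<beta>)]) \<in> productions"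
| W_snoc: "\<alpha> \<in> contents \<Longrightarrow> \<beta> \<in> contents \<Longrightarrow> (W (\<alpha> @ [c]) (\<beta> @ [c]), [Nt (W \<alpha> \<beta>)]) \<in> productions"
| W_comp: "\<alpha> \<in> contents \<Longrightarrow> \<beta> \<in> contents \<Longrightarrow> \<gamma> \<in> contents \<Longrightarrow>
    (W \<alpha> \<beta>, [Nt (W \<alpha> \<gamma>), Nt (W \<gamma> \<beta>)]) \<in> productions"
| Z_Nil: "k \<le> K \<Longrightarrow> (Z (replicate k False), []) \<in> productions"
| Z_step: "s \<in> \<Sigma> \<Longrightarrow> \<alpha> \<in> contents \<Longrightarrow> length \<alpha> \<le> N \<Longrightarrow>
    (Z \<alpha>, [Tm s, Nt (Z (f s (\<alpha> @ replicate (N - length \<alpha>) False)))]) \<in> productions"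
| Z_snoc: "\<alpha> \<in> contents \<Longrightarrow> (Z (\<alpha> @ [False]), [Nt (Z \<alpha>)]) \<in> productions"
| Z_comp: "\<alpha> \<in> contents \<Longrightarrow> \<gamma> \<in> contents \<Longrightarrow> (Z \<alpha>, [Nt (W \<alpha> \<gamma>), Nt (Z \<gamma>)]) \<in> productions"

lemma finite_productions: "finite productions"
proof (rule finite_subset)
  define E where "E = {\<alpha> :: bool list. length \<alpha> \<le> Suc K}"
  define NT where "NT = (\<lambda>(\<alpha>, \<beta>). W \<alpha> \<beta>) ` (E \<times> E) \<union> Z ` E"
  have NT: "length \<alpha> \<le> Suc K \<Longrightarrow> length \<beta> \<le> Suc K \<Longrightarrow> W \<alpha> \<beta> \<in> NT"
    "length \<alpha> \<le> Suc K \<Longrightarrow> Z \<alpha> \<in> NT" for \<alpha> \<beta>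
    by (auto simp: NT_def E_def)
  have f: "s \<in> \<Sigma> \<Longrightarrow> length \<alpha> = N \<Longrightarrow> length (f s \<alpha>) \<le> Suc K" for s \<alpha>
    using length_f le_SucI by blast
  let ?A = "Nt ` NT \<union> Tm ` \<Sigma>"
  show "productions \<subseteq> NT \<times> {\<delta>. set \<delta> \<subseteq> ?A \<and> length \<delta> \<le> 2}"
  proof
    fix p assume p: "p \<in> productions"
    obtain X \<delta> where X: "p = (X, \<delta>)" by (cases p)
    from p show "p \<in> NT \<times> {\<delta>. set \<delta> \<subseteq> ?A \<and> length \<delta> \<le> 2}"
      unfolding X by cases (auto simp: contents_def intro!: NT imageI f)
  qed
  have "finite E" using finite_lists_length_le[of "UNIV :: bool set" "Suc K"] by (simp add: E_def)
  then have "finite NT" by (simp add: NT_def)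
  then show "finite (NT \<times> {\<delta>. set \<delta> \<subseteq> ?A \<and> length \<delta> \<le> 2})"
    using finite_letters finite_lists_length_le[of ?A 2] by simp
qed

lemma h_pad:
  assumes "s \<in> \<Sigma>" "length \<alpha> \<le> N"
  shows "h s (\<alpha> @- sconst False) = f s (\<alpha> @ replicate (N - length \<alpha>) False) @- sconst False"
  using h[OF assms(1), of "\<alpha> @ replicate (N - length \<alpha>) False" "sconst False"] assms(2) by simp

lemma sconst_cons: "x ## sconst x = sconst x"
  using shift_replicate_sconst[of 1 x] by simp

lemma productions_sound: "(X, \<delta>) \<in> productions \<Longrightarrow> concat_lang meaning \<delta> \<subseteq> meaning X"
  by (erule productions.cases) (auto simp: meaning_W meaning_Z h h_pad sconst_cons)

text \<open>
  Let \<open>\<alpha> = \<alpha>' @ [c]\<close> be longer than \<open>N\<close>. Either \<open>\<alpha>'\<close> alone suffices to read \<open>w\<close>, and \<open>c\<close> can be dropped, or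
  at some moment the remainder \<open>\<gamma>\<close> of \<open>\<alpha>'\<close> has fewer than \<open>N\<close> digits. At this moment the content \<open>\<gamma> @ [c]\<close>
  has at most \<open>N\<close> digits, and \<open>w\<close> is split there. The induction is on the length of \<open>w\<close>, then on that of \<open>\<alpha>\<close>.
\<close>

lemma W_complete:
  assumes "run w \<alpha> = Some \<beta>" "w \<in> lists \<Sigma>" "\<alpha> \<in> contents" "\<beta> \<in> contents"
  shows "yields productions [Nt (W \<alpha> \<beta>)] w"
  using assms
proof (induction "length w" arbitrary: w \<alpha> \<beta> rule: less_induct)
  case outer: less
  from outer.prems show ?case
  proof (induction "length \<alpha>" arbitrary: \<alpha> \<beta> rule: less_induct)
    case inner: less
    note prems = inner.prems
    show ?case
    proof (cases w)
      case Nil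
      then have "(W \<alpha> \<beta>, []) \<in> productions" using prems W_Nil by simp
      then show ?thesis using Nil yields_production by fastforce
    next
      case (Cons s w')
      with prems have s: "s \<in> \<Sigma>" "w' \<in> lists \<Sigma>" "N \<le> length \<alpha>"
        and r: "run w' (f s (take N \<alpha>) @ drop N \<alpha>) = Some \<beta>" by (auto split: if_splits)
      show ?thesis
      proof (cases "length \<alpha> = N")
        case True
        have "f s \<alpha> \<in> contents" using length_f s True by (simp add: contents_def)
        then have "yields productions [Nt (W (f s \<alpha>) \<beta>)] w'"
          using outer.hyps[of w' "f s \<alpha>" \<beta>] Cons r True s prems by simp
        then have "yields productions [Tm s, Nt (W (f s \<alpha>) \<beta>)] w" unfolding Cons by (rule yields_Tm)
        moreover have "(W \<alpha> \<beta>, [Tm s, Nt (W (f s \<alpha>) \<beta>)]) \<in> productions"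
          using W_step s True prems by blast
        ultimately show ?thesis by (rule yields_production[rotated])
      next
        case False
        then have N: "N < length \<alpha>" using s by simp
        then obtain \<alpha>' c where \<alpha>: "\<alpha> = \<alpha>' @ [c]" by (cases \<alpha> rule: rev_cases) auto
        then have \<alpha>': "\<alpha>' \<in> contents" "N \<le> length \<alpha>'" using prems N by (auto simp: contents_def)
        show ?thesis
        proof (rule run_first_exit[of w \<alpha>'])
          fix \<beta>' assume r': "run w \<alpha>' = Some \<beta>'"
          then have \<beta>: "\<beta> = \<beta>' @ [c]" using run_extend[OF r', of "[c]"] prems \<alpha> by simp
          then have \<beta>': "\<beta>' \<in> contents" using prems by (simp add: contents_def)
          have "yields productions [Nt (W \<alpha>' \<beta>')] w" using inner.hyps[OF _ r'] \<alpha> \<alpha>' \<beta>' prems by simp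
          moreover have "(W \<alpha> \<beta>, [Nt (W \<alpha>' \<beta>')]) \<in> productions"
            unfolding \<alpha> \<beta> using W_snoc \<alpha>' \<beta>' by blast
          ultimately show ?thesis by (rule yields_production[rotated])
        next
          fix w1 w2 \<gamma> assume w: "w = w1 @ w2" "w2 \<noteq> []" and r1: "run w1 \<alpha>' = Some \<gamma>" and \<gamma>: "length \<gamma> < N"
          have "w1 \<noteq> []" using r1 \<gamma> \<alpha>' by auto
          have l: "w1 \<in> lists \<Sigma>" "w2 \<in> lists \<Sigma>" using prems w by auto
          have D: "\<gamma> \<in> contents" "\<gamma> @ [c] \<in> contents" using \<gamma> N_le_K by (auto simp: contents_def)
          have "yields productions [Nt (W \<alpha>' \<gamma>)] w1"
            using outer.hyps[OF _ r1 l(1) \<alpha>'(1) D(1)] w by simp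
          moreover have "(W \<alpha> (\<gamma> @ [c]), [Nt (W \<alpha>' \<gamma>)]) \<in> productions"
            unfolding \<alpha> using W_snoc \<alpha>' D by blast
          ultimately have 1: "yields productions [Nt (W \<alpha> (\<gamma> @ [c]))] w1" by (rule yields_production[rotated])
          have "run w2 (\<gamma> @ [c]) = Some \<beta>"
            using prems(1) run_extend[OF r1, of "[c]"] by (simp add: w \<alpha> run_append)
          then have 2: "yields productions [Nt (W (\<gamma> @ [c]) \<beta>)] w2"
            using outer.hyps[OF _ _ l(2) D(2)] w \<open>w1 \<noteq> []\<close> prems by simp
          have "(W \<alpha> \<beta>, [Nt (W \<alpha> (\<gamma> @ [c])), Nt (W (\<gamma> @ [c]) \<beta>)]) \<in> productions"
            using W_comp prems D by blast
          then show ?thesis unfolding w(1) by (rule yields_production[OF _ yields_pair[OF 1 2]])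
        qed
      qed
    qed
  qed
qed

text \<open>
  As in \<open>W_complete\<close>. A short \<open>\<alpha>\<close> is padded with zeros, and if \<open>c\<close> is never touched then it must be a zero and
  is absorbed by the zeros below.
\<close>

lemma Z_complete:
  assumes "fold h w (\<alpha> @- sconst False) = sconst False" "w \<in> lists \<Sigma>" "\<alpha> \<in> contents"
  shows "yields productions [Nt (Z \<alpha>)] w"
  using assms
proof (induction "length w" arbitrary: w \<alpha> rule: less_induct)
  case outer: less
  from outer.prems show ?case
  proof (induction "length \<alpha>" arbitrary: \<alpha> rule: less_induct)
    case inner: less
    note prems = inner.prems
    show ?case
    proof (cases w)
      case Nil
      then have "\<alpha> = replicate (length \<alpha>) False" "length \<alpha> \<le> K"
        using prems by (auto simp: shift_sconst_eq contents_def)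
      then have "(Z \<alpha>, []) \<in> productions" using Z_Nil by metis
      then show ?thesis using Nil yields_production by fastforce
    next
      case (Cons s w')
      with prems have s: "s \<in> \<Sigma>" "w' \<in> lists \<Sigma>" by auto
      show ?thesis
      proof (cases "length \<alpha> \<le> N")
        case True
        let ?\<beta> = "f s (\<alpha> @ replicate (N - length \<alpha>) False)"
        have "?\<beta> \<in> contents" using length_f s True by (simp add: contents_def)
        then have "yields productions [Nt (Z ?\<beta>)] w'"
          using outer.hyps[of w' ?\<beta>] Cons prems s h_pad[OF s(1) True] by simp
        then have "yields productions [Tm s, Nt (Z ?\<beta>)] w" unfolding Cons by (rule yields_Tm)
        moreover have "(Z \<alpha>, [Tm s, Nt (Z ?\<beta>)]) \<in> productions"
          using Z_step s True prems by blast
        ultimately show ?thesis by (rule yields_production[rotated])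
      next
        case False
        then have N: "N < length \<alpha>" by simp
        then obtain \<alpha>' c where \<alpha>: "\<alpha> = \<alpha>' @ [c]" by (cases \<alpha> rule: rev_cases) auto
        then have \<alpha>': "\<alpha>' \<in> contents" "N \<le> length \<alpha>'" using prems N by (auto simp: contents_def)
        show ?thesis
        proof (rule run_first_exit[of w \<alpha>'])
          fix \<beta> assume r: "run w \<alpha>' = Some \<beta>"
          have "fold h w (\<alpha> @- sconst False) = (\<beta> @ [c]) @- sconst False"
            using run_sound[OF run_extend[OF r, of "[c]"]] prems \<alpha> by simp
          then have "(\<beta> @ [c]) @- sconst False = sconst False" using prems by simp
          from arg_cong[OF this, of sset] have "set (\<beta> @ [c]) \<subseteq> {False}"
            unfolding sset_shift by auto
          then have c: "c = False" and \<beta>: "\<beta> = replicate (length \<beta>) False"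
            by (auto intro!: replicate_eqI)
          have "fold h w (\<alpha>' @- sconst False) = sconst False"
            using run_sound[OF r] prems \<beta> shift_sconst_eq by metis
          then have "yields productions [Nt (Z \<alpha>')] w" using inner.hyps \<alpha> \<alpha>' prems by simp
          moreover have "(Z \<alpha>, [Nt (Z \<alpha>')]) \<in> productions"
            unfolding \<alpha> c using Z_snoc \<alpha>' by blast
          ultimately show ?thesis by (rule yields_production[rotated])
        next
          fix w1 w2 \<gamma> assume w: "w = w1 @ w2" "w2 \<noteq> []" and r1: "run w1 \<alpha>' = Some \<gamma>" and \<gamma>: "length \<gamma> < N"
          have "w1 \<noteq> []" using r1 \<gamma> \<alpha>' by auto
          have l: "w1 \<in> lists \<Sigma>" "w2 \<in> lists \<Sigma>" using prems w by auto
          have D: "\<gamma> @ [c] \<in> contents" using \<gamma> N_le_K by (auto simp: contents_def)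
          have r2: "run w1 \<alpha> = Some (\<gamma> @ [c])" using run_extend[OF r1, of "[c]"] \<alpha> by simp
          have 1: "yields productions [Nt (W \<alpha> (\<gamma> @ [c]))] w1"
            by (rule W_complete[OF r2 l(1) prems(3) D])
          have "fold h w2 ((\<gamma> @ [c]) @- sconst False) = sconst False"
            using run_sound[OF r2 l(1), of "sconst False"] prems(1) w by simp
          then have 2: "yields productions [Nt (Z (\<gamma> @ [c]))] w2"
            using outer.hyps[OF _ _ l(2) D] w \<open>w1 \<noteq> []\<close> by simp
          have "(Z \<alpha>, [Nt (W \<alpha> (\<gamma> @ [c])), Nt (Z (\<gamma> @ [c]))]) \<in> productions"
            using Z_comp prems D by blast
          then show ?thesis unfolding w(1) by (rule yields_production[OF _ yields_pair[OF 1 2]])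
        qed
      qed
    qed
  qed
qed

lemma context_free_stabilizer:
  "context_free {w \<in> lists \<Sigma>. fold h w (sconst False) = sconst False}"
proof -
  have "yields productions [Nt (Z [])] w \<longleftrightarrow> w \<in> lists \<Sigma> \<and> fold h w (sconst False) = sconst False" for w
  proof
    assume "yields productions [Nt (Z [])] w"
    from yields_sound[OF productions_sound this] show "w \<in> lists \<Sigma> \<and> fold h w (sconst False) = sconst False"
      by (auto simp: meaning_Z)
  next
    assume "w \<in> lists \<Sigma> \<and> fold h w (sconst False) = sconst False"
    then show "yields productions [Nt (Z [])] w" using Z_complete[of w "[]"] by (simp add: contents_def)
  qed
  then have "grammar_language productions (Z []) = {w \<in> lists \<Sigma>. fold h w (sconst False) = sconst False}"
    by (simp add: grammar_language_yields)
  then show ?thesis unfolding context_free_def using finite_productions by metis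
qed

end

lemma context_free_point_stabilizer:
  assumes "finite \<Sigma>" "\<And>s. s \<in> \<Sigma> \<Longrightarrow> h s \<in> carrier Thompson_V"
  shows "context_free {w \<in> lists \<Sigma>. fold h w (sconst False) = sconst False}"
proof -
  have "\<forall>s\<in>\<Sigma>. \<exists>N f. \<forall>\<alpha>. length \<alpha> = N \<longrightarrow> (\<forall>\<eta>. h s (\<alpha> @- \<eta>) = f \<alpha> @- \<eta>)"
    using assms Thompson_V_uniform(2) by blast
  then obtain n k where nk: "\<And>s \<alpha> \<eta>. s \<in> \<Sigma> \<Longrightarrow> length \<alpha> = n s \<Longrightarrow> h s (\<alpha> @- \<eta>) = k s \<alpha> @- \<eta>"
    by metis
  define N where "N = Max (insert 0 (n ` \<Sigma>))"
  have N: "n s \<le> N" if "s \<in> \<Sigma>" for s unfolding N_def using assms that by (intro Max_ge) auto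
  define f where "f s \<alpha> = k s (take (n s) \<alpha>) @ drop (n s) \<alpha>" for s \<alpha>
  have h: "h s (\<alpha> @- \<eta>) = f s \<alpha> @- \<eta>" if "s \<in> \<Sigma>" "length \<alpha> = N" for s \<alpha> \<eta>
    using nk[OF that(1), of "take (n s) \<alpha>" "drop (n s) \<alpha> @- \<eta>"] N[OF that(1)] that(2)
    by (simp add: f_def min_def flip: shift_append)
  let ?L = "(\<lambda>(s, \<alpha>). length (f s \<alpha>)) ` (\<Sigma> \<times> {\<alpha>. length \<alpha> = N})"
  define K where "K = Max (insert N ?L)"
  have fin: "finite (insert N ?L)"
    using assms(1) finite_lists_length_eq[of "UNIV :: bool set" N] by simp
  have K: "m \<le> K" if "m \<in> insert N ?L" for m unfolding K_def by (rule Max_ge[OF fin that])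
  interpret prefix_machine \<Sigma> h f N K
  proof
    show "length (f s \<alpha>) \<le> K" if "s \<in> \<Sigma>" "length \<alpha> = N" for s \<alpha>
      using that by (intro K insertI2 image_eqI[of _ _ "(s, \<alpha>)"]) auto
  qed (use assms h K in auto)
  show ?thesis by (rule context_free_stabilizer)
qed

section \<open>Context-free subgroups and V\<close>

lemma hom_Thompson_V:
  assumes "group G" "\<phi> \<in> hom G Thompson_V"
  shows "\<phi> \<one>\<^bsub>G\<^esub> = id"
    "g \<in> carrier G \<Longrightarrow> g' \<in> carrier G \<Longrightarrow> \<phi> (g \<otimes>\<^bsub>G\<^esub> g') = \<phi> g' \<circ> \<phi> g"
    "g \<in> carrier G \<Longrightarrow> \<phi> g \<in> carrier Thompson_V"
proof -
  interpret group G by fact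
  show mult: "g \<in> carrier G \<Longrightarrow> g' \<in> carrier G \<Longrightarrow> \<phi> (g \<otimes>\<^bsub>G\<^esub> g') = \<phi> g' \<circ> \<phi> g" for g g'
    using hom_mult[OF assms(2)] by (simp add: Thompson_V_def)
  show V: "g \<in> carrier G \<Longrightarrow> \<phi> g \<in> carrier Thompson_V" for g
    using assms(2) by (auto simp: hom_def)
  have "inj (\<phi> \<one>\<^bsub>G\<^esub>)" by (rule bij_is_inj[OF Thompson_V_uniform(1)[OF V[OF one_closed]]])
  moreover have "\<phi> \<one>\<^bsub>G\<^esub> (\<phi> \<one>\<^bsub>G\<^esub> \<xi>) = \<phi> \<one>\<^bsub>G\<^esub> \<xi>" for \<xi>
    using fun_cong[OF mult[OF one_closed one_closed], of \<xi>] by simp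
  ultimately show "\<phi> \<one>\<^bsub>G\<^esub> = id" by (auto simp: inj_eq fun_eq_iff)
qed

lemma symmetric_generators:
  fixes G :: "('a, 'b) monoid_scheme" (structure)
  assumes "group G" "finitely_generated G"
  obtains \<Sigma> :: "nat set" and bar \<rho> where "symmetric_alphabet \<Sigma> bar" "symmetric_hom \<Sigma> bar G \<rho>"
    "\<rho> ` lists \<Sigma> = carrier G"
proof -
  interpret group G by fact
  obtain S where S: "finite S" "S \<subseteq> carrier G" "generate G S = carrier G"
    using assms by (auto simp: finitely_generated_def)
  define T where "T = S \<union> m_inv G ` S"
  have T: "finite T" "T \<subseteq> carrier G" "\<And>t. t \<in> T \<Longrightarrow> inv t \<in> T"
    using S by (auto simp: T_def)
  obtain e :: "'a \<Rightarrow> nat" where e: "inj_on e T" using finite_imp_inj_to_nat_seg[OF T(1)] by blast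
  define d where "d = inv_into T e"
  have d: "d (e t) = t" if "t \<in> T" for t using inv_into_f_f[OF e that] by (simp add: d_def)
  define \<Sigma> where "\<Sigma> = e ` T"
  define bar where "bar s = e (inv (d s))" for s
  define \<rho> where "\<rho> w = foldr (\<lambda>s x. d s \<otimes> x) w \<one>" for w
  have \<Sigma>: "d s \<in> carrier G" "bar s \<in> \<Sigma>" "bar (bar s) = s" "d (bar s) = inv (d s)" if "s \<in> \<Sigma>" for s
    using that d T by (auto simp: \<Sigma>_def bar_def subset_iff)
  have alphabet: "symmetric_alphabet \<Sigma> bar" using \<Sigma> T by (simp add: symmetric_alphabet_def \<Sigma>_def)
  have closed: "\<rho> w \<in> carrier G" if "w \<in> lists \<Sigma>" for w
    using that by (induction w) (auto simp: \<rho>_def \<Sigma>)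
  have append: "\<rho> (u @ v) = \<rho> u \<otimes> \<rho> v" if "u \<in> lists \<Sigma>" "v \<in> lists \<Sigma>" for u v
    using that(1)
  proof (induction u)
    case (Cons s u)
    then show ?case using closed[OF Cons(2)] closed[OF that(2)] \<Sigma>(1)[OF Cons(1)]
      by (simp add: \<rho>_def m_assoc)
  qed (use closed[OF that(2)] in \<open>simp add: \<rho>_def\<close>)
  have word_bar: "word_bar bar u \<in> lists \<Sigma> \<and> \<rho> (word_bar bar u) = inv (\<rho> u)" if "u \<in> lists \<Sigma>" for u
    using that
  proof (induction u)
    case (Cons s u)
    have "\<rho> (word_bar bar (s # u)) = \<rho> (word_bar bar u) \<otimes> \<rho> [bar s]"
      using append[of "word_bar bar u" "[bar s]"] Cons \<Sigma>(2) by (simp add: word_bar_def)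
    also have "\<dots> = inv (d s \<otimes> \<rho> u)"
      using Cons \<Sigma>(1,4)[OF Cons(1)] closed[OF Cons(2)] by (simp add: inv_mult_group) (simp add: \<rho>_def \<Sigma>(1,4)[OF Cons(1)])
    finally show ?case using Cons \<Sigma>(2) by (auto simp: word_bar_def \<rho>_def)
  qed (simp add: word_bar_def \<rho>_def)
  have hom: "symmetric_hom \<Sigma> bar G \<rho>"
    using closed append word_bar
    by (auto simp: symmetric_hom_def hom_def word_monoid_def) (simp add: \<rho>_def)
  have "g \<in> \<rho> ` lists \<Sigma>" if "g \<in> generate G S" for g
    using that
  proof (induction rule: generate.induct)
    case one
    then show ?case by (intro image_eqI[of _ _ "[]"]) (auto simp: \<rho>_def)
  next
    case (incl g)
    then have "g \<in> T" "g \<in> carrier G" using S by (auto simp: T_def)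
    then show ?case by (intro image_eqI[of _ _ "[e g]"]) (auto simp: \<rho>_def d \<Sigma>_def)
  next
    case (inv g)
    then have "inv g \<in> T" "inv g \<in> carrier G" using S by (auto simp: T_def)
    then show ?case by (intro image_eqI[of _ _ "[e (inv g)]"]) (auto simp: \<rho>_def d \<Sigma>_def)
  next
    case (eng g h)
    then obtain u v where "u \<in> lists \<Sigma>" "\<rho> u = g" "v \<in> lists \<Sigma>" "\<rho> v = h" by blast
    then show ?case using append by (intro image_eqI[of _ _ "u @ v"]) auto
  qed
  then have "\<rho> ` lists \<Sigma> = carrier G" using closed S(3) by blast
  then show ?thesis using that alphabet hom by blast
qed

theorem context_free_if_hom_to_Thompson_V:
  fixes G :: "('a, 'b) monoid_scheme" (structure) and H :: "'a set"
  assumes "group G" "finitely_generated G" and \<phi>: "\<phi> \<in> hom G Thompson_V"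
    and H: "{g \<in> carrier G. \<phi> g \<in> Thompson_V_stab} = H"
  shows "context_free_subgroup H G"
proof -
  interpret group G by fact
  obtain \<Sigma> :: "nat set" and bar \<rho> where \<Sigma>: "symmetric_alphabet \<Sigma> bar" and hom: "symmetric_hom \<Sigma> bar G \<rho>"
    and onto: "\<rho> ` lists \<Sigma> = carrier G" using symmetric_generators[OF assms(1,2)] by blast
  note \<rho> = symmetric_homD[OF hom] and V = hom_Thompson_V[OF assms(1) \<phi>]
  define h where "h s = \<phi> (\<rho> [s])" for s
  have word: "\<phi> (\<rho> w) = fold h w" if "w \<in> lists \<Sigma>" for w
    using that
  proof (induction w)
    case (Cons s w)
    then have "\<phi> (\<rho> ([s] @ w)) = \<phi> (\<rho> w) \<circ> \<phi> (\<rho> [s])"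
      using V(2)[of "\<rho> [s]" "\<rho> w"] \<rho>(1)[of "[s]"] \<rho>(1)[of w] \<rho>(2)[of "[s]" w] by simp
    then show ?case using Cons by (simp add: h_def)
  qed (simp add: \<rho>(3) V(1))
  have "\<rho> w \<in> H \<longleftrightarrow> fold h w (sconst False) = sconst False" if "w \<in> lists \<Sigma>" for w
    using \<rho>(1)[OF that] V(3)[OF \<rho>(1)[OF that]] word[OF that] unfolding H[symmetric] Thompson_V_stab_def by simp
  then have "membership_problem \<Sigma> \<rho> H = {w \<in> lists \<Sigma>. fold h w (sconst False) = sconst False}"
    unfolding membership_problem_def by blast
  moreover have "h s \<in> carrier Thompson_V" if "s \<in> \<Sigma>" for s
    unfolding h_def using that by (intro V(3) \<rho>(1)) simp
  ultimately have "context_free (membership_problem \<Sigma> \<rho> H)"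
    using context_free_point_stabilizer[of \<Sigma> h] \<Sigma> by (simp add: symmetric_alphabet_def)
  then show ?thesis unfolding context_free_subgroup_def using \<Sigma> hom onto by blast
qed


theorem theorem1:
  fixes G :: "('a, 'b) monoid_scheme" and H :: "'a set"
  assumes "group G" and "finitely_generated G" and "subgroup H G"
  shows "context_free_subgroup H G \<longleftrightarrow>
    (\<exists>\<phi> \<in> hom G Thompson_V. {g \<in> carrier G. \<phi> g \<in> Thompson_V_stab} = H)"
  using hom_to_Thompson_V_if_context_free[OF assms(1,3)]
    context_free_if_hom_to_Thompson_V[OF assms(1,2)] by blast

end
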